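(* Let $p\in[1,2]$, let $\varepsilon,\delta\in(0,1/20]$ and $\gamma\in(0,1)$. Let $A\in\mathbb{R}^{n\times d}$ with rows $a_1,\dots,a_n$ be presented as a turnstile data stream, and let $L$ be the list output by the heavy-hitter algorithm described in the context, run with parameters $s,r,\varepsilon$. Let $S_R(r/20)\subseteq[n]$ be the set of indices remaining after removing the $r/20$ indices $i$ with the largest values of $\|a_i\|_p$ (ties broken arbitrarily), and let $M=\sum_{i\in S_R(r/20)}\|a_i\|_p^p$. If $r=8\gamma^{-1}(12/\varepsilon)^p$ and $s\ge 3\ln(6n/\delta)/0.025^3$, then with probability at least $1-\delta$ the following hold: for every element $(i,\tilde a_i)\in L$ we have $\|\tilde a_i-a_i\|_p\le(\varepsilon/3)\|a_i\|_p$ and $(1-\varepsilon)\|a_i\|_p^p\le\|\tilde a_i\|_p^p\le(1+\varepsilon)\|a_i\|_p^p$; and for every $i\in[n]$ with $\|a_i\|_p^p\ge\gamma M$, some element with first coordinate $i$ belongs to $L$.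
   Context: Turnstile data stream: the matrix $A\in\mathbb{R}^{n\times d}$ starts as the zero matrix and is modified by a sequence of additive updates (an update adds a vector $x\in\mathbb{R}^d$ to a row $a_i$, or a value to a single entry); $A$ denotes the final matrix. For $v\in\mathbb{R}^d$, $\|v\|_p=(\sum_j|v_j|^p)^{1/p}$. Heavy-hitter algorithm (a CountSketch variant) with parameters $s,r\in\mathbb{N}$ and $\varepsilon>0$: independently for every $i\in[n]$ and $j\in[s]$ draw $h_{i,j}\in[r]$ uniformly at random and a sign $\sigma_{i,j}\in\{-1,1\}$ uniformly at random. For each $j\in[s]$ maintain $B_j\in\mathbb{R}^{r\times d}$ whose row $b$ equals $B_{j,b}=\sum_{i:\,h_{i,j}=b}\sigma_{i,j}a_i$ (maintained linearly under the updates). After the stream: let $M_0$ be the $0.65$-percentile of the multiset $\{\|B_{j,1}\|_p^p : j\in[s]\}$. For each $i\in[n]$ and $j\in[s]$ set $\tilde a_{i,j}=\sigma_{i,j}B_{j,h_{i,j}}$ and $v_i=\operatorname{median}_{j\in[s]}\|\tilde a_{i,j}\|_p^p$. If $v_i\ge(12/\varepsilon)^pM_0$, pick $j\in[s]$ minimizing $\operatorname{median}_{j'\in[s]}\|\tilde a_{i,j}-\tilde a_{i,j'}\|_p^p$ and add $(i,\tilde a_{i,j})$ to $L$. Output $L$. All randomness is fully independent. *)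

theory Defs
  imports "HOL-Probability.Probability" "HOL-Probability.Product_PMF"
begin

definition pnorm :: "real \<Rightarrow> real ^ 'd \<Rightarrow> real" where
  "pnorm p v = (\<Sum>j\<in>UNIV. \<bar>v $ j\<bar> powr p) powr (1 / p)"


subsection \<open>Turnstile streams\<close>

datatype ('n, 'd::finite) turnstile_update =
    Row_Update 'n "real ^ 'd"
  | Entry_Update 'n 'd real

fun updated_row :: "('n, 'd::finite) turnstile_update \<Rightarrow> 'n" where
  "updated_row (Row_Update i x) = i"
| "updated_row (Entry_Update i k c) = i"

fun increment :: "('n, 'd::finite) turnstile_update \<Rightarrow> real ^ 'd" where
  "increment (Row_Update i x) = x"
| "increment (Entry_Update i k c) = axis k c"

definition matrix_step ::
  "real ^ 'd ^ 'n \<Rightarrow> ('n::finite, 'd::finite) turnstile_update \<Rightarrow> real ^ 'd ^ 'n" where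
  "matrix_step A u = (\<chi> i. if i = updated_row u then A $ i + increment u else A $ i)"

definition final_matrix :: "('n::finite, 'd::finite) turnstile_update list \<Rightarrow> real ^ 'd ^ 'n" where
  "final_matrix us = foldl matrix_step 0 us"


subsection \<open>Order statistics of finite multisets\<close>

text \<open>
  Nearest-rank convention: for \<open>0 < q \<le> 1\<close> and nonempty \<open>X\<close> this is the smallest element
  \<open>x\<close> of \<open>X\<close> such that at least a \<open>q\<close>-fraction of the elements of \<open>X\<close> is at most \<open>x\<close>.
\<close>

definition percentile :: "real \<Rightarrow> real multiset \<Rightarrow> real" where
  "percentile q X = sorted_list_of_multiset X ! (nat \<lceil>q * real (size X)\<rceil> - 1)"

text \<open>The mean of the two middle elements if the size is even.\<close>

definition median :: "real multiset \<Rightarrow> real" where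
  "median X = (sorted_list_of_multiset X ! ((size X - 1) div 2)
             + sorted_list_of_multiset X ! (size X div 2)) / 2"


subsection \<open>The heavy-hitter algorithm\<close>

text \<open>
  The random choices are a pair \<open>(h, \<sigma>)\<close>, with \<open>h (i, j)\<close> the bucket and \<open>\<sigma> (i, j)\<close> the sign of
  row \<open>i\<close> in repetition \<open>j\<close>. Repetitions are numbered \<open>1, \<dots>, s\<close> and buckets \<open>1, \<dots>, r\<close>.
\<close>

type_synonym 'n coins = "('n \<times> nat \<Rightarrow> nat) \<times> ('n \<times> nat \<Rightarrow> real)"

definition coins_pmf :: "nat \<Rightarrow> nat \<Rightarrow> 'n::finite coins pmf" where
  "coins_pmf s r = pair_pmf
     (Pi_pmf (UNIV \<times> {1..s}) 1 (\<lambda>_. pmf_of_set {1..r}))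
     (Pi_pmf (UNIV \<times> {1..s}) 1 (\<lambda>_. pmf_of_set {-1, 1}))"

definition sketch_step :: "'n coins \<Rightarrow> (nat \<Rightarrow> nat \<Rightarrow> real ^ 'd)
    \<Rightarrow> ('n, 'd::finite) turnstile_update \<Rightarrow> (nat \<Rightarrow> nat \<Rightarrow> real ^ 'd)" where
  "sketch_step \<omega> B u = (case \<omega> of (h, \<sigma>) \<Rightarrow> (\<lambda>j b.
     if b = h (updated_row u, j) then B j b + \<sigma> (updated_row u, j) *\<^sub>R increment u else B j b))"

definition sketch ::
  "'n coins \<Rightarrow> ('n, 'd::finite) turnstile_update list \<Rightarrow> nat \<Rightarrow> nat \<Rightarrow> real ^ 'd" where
  "sketch \<omega> us = foldl (sketch_step \<omega>) (\<lambda>j b. 0) us"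

lemma sketch_eq_sum:
  fixes us :: "('n::finite, 'd::finite) turnstile_update list"
  shows "sketch (h, \<sigma>) us j b
    = (\<Sum>i | h (i, j) = b. \<sigma> (i, j) *\<^sub>R (final_matrix us $ i))"
proof (induction us rule: rev_induct)
  case Nil
  then show ?case by (simp add: sketch_def final_matrix_def)
next
  case (snoc u us)
  have step: "final_matrix (us @ [u]) $ i
      = final_matrix us $ i + (if i = updated_row u then increment u else 0)" for i
    by (simp add: final_matrix_def matrix_step_def)
  have "(\<Sum>i | h (i, j) = b. \<sigma> (i, j) *\<^sub>R (final_matrix (us @ [u]) $ i))
      = (\<Sum>i | h (i, j) = b. \<sigma> (i, j) *\<^sub>R (final_matrix us $ i)
          + (if i = updated_row u then \<sigma> (i, j) *\<^sub>R increment u else 0))"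
    unfolding step by (intro sum.cong) (simp_all add: scaleR_right_distrib)
  also have "\<dots> = (\<Sum>i | h (i, j) = b. \<sigma> (i, j) *\<^sub>R (final_matrix us $ i))
      + (if h (updated_row u, j) = b then \<sigma> (updated_row u, j) *\<^sub>R increment u else 0)"
    by (simp add: sum.distrib)
  also have "\<dots> = sketch (h, \<sigma>) (us @ [u]) j b"
    unfolding snoc [symmetric] by (auto simp: sketch_def sketch_step_def)
  finally show ?case ..
qed

definition row_estimate ::
  "'n coins \<Rightarrow> (nat \<Rightarrow> nat \<Rightarrow> real ^ 'd) \<Rightarrow> 'n \<Rightarrow> nat \<Rightarrow> real ^ 'd" where
  "row_estimate \<omega> B i j = (case \<omega> of (h, \<sigma>) \<Rightarrow> \<sigma> (i, j) *\<^sub>R B j (h (i, j)))"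

definition noise_level :: "real \<Rightarrow> nat \<Rightarrow> (nat \<Rightarrow> nat \<Rightarrow> real ^ 'd) \<Rightarrow> real" where
  "noise_level p s B = percentile 0.65 {# pnorm p (B j 1) powr p. j \<in># mset_set {1..s} #}"

definition norm_estimate ::
  "real \<Rightarrow> nat \<Rightarrow> 'n coins \<Rightarrow> (nat \<Rightarrow> nat \<Rightarrow> real ^ 'd) \<Rightarrow> 'n \<Rightarrow> real" where
  "norm_estimate p s \<omega> B i
     = median {# pnorm p (row_estimate \<omega> B i j) powr p. j \<in># mset_set {1..s} #}"

definition spread ::
  "real \<Rightarrow> nat \<Rightarrow> 'n coins \<Rightarrow> (nat \<Rightarrow> nat \<Rightarrow> real ^ 'd) \<Rightarrow> 'n \<Rightarrow> nat \<Rightarrow> real" where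
  "spread p s \<omega> B i j = median
     {# pnorm p (row_estimate \<omega> B i j - row_estimate \<omega> B i j') powr p. j' \<in># mset_set {1..s} #}"

text \<open>
  \<open>heavy_hitter_output p \<epsilon> s \<omega> B L\<close>: on random choices \<open>\<omega>\<close> and sketch \<open>B\<close> the algorithm may
  output \<open>L\<close>. This is a relation because ties in the minimisation over \<open>j\<close> are broken
  arbitrarily. Each row contributes at most one element and their order plays no role, so the
  output list is represented by its set of elements.
\<close>

definition heavy_hitter_output :: "real \<Rightarrow> real \<Rightarrow> nat \<Rightarrow> 'n coins
    \<Rightarrow> (nat \<Rightarrow> nat \<Rightarrow> real ^ 'd) \<Rightarrow> ('n \<times> (real ^ 'd)) set \<Rightarrow> bool" where
  "heavy_hitter_output p \<epsilon> s \<omega> B L \<longleftrightarrow>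
     (\<exists>pick. (\<forall>i. is_arg_min (spread p s \<omega> B i) (\<lambda>j. j \<in> {1..s}) (pick i)) \<and>
        L = {(i, row_estimate \<omega> B i (pick i)) | i.
               norm_estimate p s \<omega> B i \<ge> (12 / \<epsilon>) powr p * noise_level p s B})"

lemma heavy_hitter_output_exists:
  assumes "s \<ge> 1"
  shows "\<exists>L. heavy_hitter_output p \<epsilon> s \<omega> B L"
proof -
  have "\<exists>j. is_arg_min (spread p s \<omega> B i) (\<lambda>j. j \<in> {1..s}) j" for i
    using assms ex_is_arg_min_if_finite[of "{1..s}" "spread p s \<omega> B i"] by simp
  then have "\<exists>pick. \<forall>i. is_arg_min (spread p s \<omega> B i) (\<lambda>j. j \<in> {1..s}) (pick i)"
    by (intro choice allI)
  then show ?thesis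
    unfolding heavy_hitter_output_def by blast
qed


subsection \<open>Removing the largest rows\<close>

text \<open>
  \<open>S\<close> is what remains after removing \<open>t\<close> rows of largest norm, for some way of breaking ties;
  everything is removed if there are fewer than \<open>t\<close> rows.
\<close>

definition remaining_rows :: "real \<Rightarrow> real ^ 'd ^ 'n \<Rightarrow> nat \<Rightarrow> 'n set \<Rightarrow> bool" where
  "remaining_rows p A t S \<longleftrightarrow> card (- S) = min t CARD('n) \<and>
     (\<forall>i\<in>S. \<forall>k\<in>- S. pnorm p (A $ i) \<le> pnorm p (A $ k))"

end

theory Submission
  imports Defs
begin

text \<open>
  Fix a row \<open>i\<close>. In one repetition, the norm of the error of the estimate of \<open>a\<^sub>i\<close> has the
  law of the norm of bucket \<open>1\<close> built without row \<open>i\<close>, so it differs from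
  \<open>\<parallel>B\<^sub>1\<parallel>\<close> only on the event \<open>h i = 1\<close> of probability \<open>1/r\<close>.
  Let \<open>q\<close> be a \<open>0.625\<close>-quantile of \<open>\<parallel>B\<^sub>1\<parallel>\<^sup>p\<close>. By
  Hoeffding's inequality, \<open>M\<^sub>0 \<ge> q\<close> and, for every \<open>i\<close>, more than \<open>0.58 s\<close>
  repetitions have error at most \<open>q \<le> M\<^sub>0\<close>. On the other hand, with probability about
  \<open>19/20\<close> no removed row falls into bucket \<open>1\<close>, and since \<open>p \<le> 2\<close> the remaining
  rows contribute at most \<open>M/r\<close> to the expectation of \<open>\<parallel>B\<^sub>1\<parallel>\<^sup>p\<close>;
  Markov's inequality then gives \<open>M\<^sub>0 \<le> 4M/r = \<gamma>M (\<epsilon>/12)\<^sup>p / 2\<close>. Everything else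
  is the triangle inequality: medians over a set of repetitions with a strict majority of errors at most
  \<open>M\<^sub>0\<^sup>1\<^sup>/\<^sup>p\<close> are within that distance of the truth, and the repetition of minimal
  spread is within \<open>3 M\<^sub>0\<^sup>1\<^sup>/\<^sup>p\<close> of \<open>a\<^sub>i\<close>.
\<close>

subsection \<open>Order statistics\<close>

text \<open>In a sorted list a downward closed predicate holds exactly on a prefix, so the test at
  position \<open>k\<close> asks whether that prefix is longer than \<open>k\<close>. With
  \<open>P\<close> as \<open>\<le> x\<close> or \<open>< x\<close>, bounds on order statistics
  become counts.\<close>

lemma sorted_nth_iff_size_filter:
  fixes xs :: "'a::linorder list"
  assumes "sorted xs" "k < length xs" and down: "\<And>x y. x \<le> y \<Longrightarrow> P y \<Longrightarrow> P x"
  shows "P (xs ! k) \<longleftrightarrow> k < length (filter P xs)"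
  using assms(1,2)
proof (induction xs arbitrary: k)
  case (Cons x xs)
  have *: "filter P xs = []" if "\<not> P x"
    using that Cons.prems(1) down by (auto simp: filter_empty_conv)
  show ?case
  proof (cases k)
    case 0
    then show ?thesis using * by auto
  next
    case (Suc m)
    then have "P (xs ! m) \<longleftrightarrow> m < length (filter P xs)"
      using Cons by auto
    then show ?thesis using Suc * by auto
  qed
qed simp

lemma sorted_list_of_multiset_nth_iff:
  fixes f :: "'a \<Rightarrow> real"
  assumes "finite J" "k < card J" and "\<And>x y. x \<le> y \<Longrightarrow> P y \<Longrightarrow> P x"
  shows "P (sorted_list_of_multiset {# f j. j \<in># mset_set J #} ! k) \<longleftrightarrow> k < card {j\<in>J. P (f j)}"
proof -
  let ?X = "{# f j. j \<in># mset_set J #}"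
  have *: "mset (sorted_list_of_multiset ?X) = ?X" by simp
  have "length (sorted_list_of_multiset ?X) = size ?X"
    by (subst (2) *[symmetric]) (rule size_mset[symmetric])
  then have "length (sorted_list_of_multiset ?X) = card J" by simp
  moreover have "length (filter P (sorted_list_of_multiset ?X)) = size (filter_mset P ?X)"
    by (subst (2) *[symmetric]) (simp only: mset_filter[symmetric] size_mset)
  then have "length (filter P (sorted_list_of_multiset ?X)) = card {j\<in>J. P (f j)}"
    using assms(1) by (simp add: filter_mset_image_mset)
  ultimately show ?thesis
    using sorted_nth_iff_size_filter[of "sorted_list_of_multiset ?X" k P] assms by simp
qed

lemma percentile_le:
  assumes "finite J" "J \<noteq> {}" "0 < q" "q \<le> 1" "q * real (card J) \<le> real (card {j\<in>J. f j \<le> x})"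
  shows "percentile q {# f j. j \<in># mset_set J #} \<le> x"
proof -
  have c: "card J > 0" using assms by (simp add: card_gt_0_iff)
  \<comment> \<open>A count is an integer, so it reaches \<open>q * card J\<close> only by reaching
    the ceiling; positions start at 0, hence the \<open>- 1\<close> below.\<close>
  have "\<lceil>q * real (card J)\<rceil> \<le> int (card {j\<in>J. f j \<le> x})" using assms(5) by (simp add: ceiling_le_iff)
  moreover have "\<lceil>q * real (card J)\<rceil> > 0" using c assms by simp
  moreover have "card {j\<in>J. f j \<le> x} \<le> card J" using assms(1) by (simp add: card_mono)
  ultimately have "nat \<lceil>q * real (card J)\<rceil> - 1 < card {j\<in>J. f j \<le> x}"
      "nat \<lceil>q * real (card J)\<rceil> - 1 < card J" by linarith+
  then show ?thesis
    unfolding percentile_def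
    using assms(1) by (subst sorted_list_of_multiset_nth_iff[where P = "\<lambda>y. y \<le> x"]) auto
qed

lemma le_percentile:
  assumes "finite J" "J \<noteq> {}" "0 < q" "q \<le> 1" "real (card {j\<in>J. f j < x}) < q * real (card J)"
  shows "x \<le> percentile q {# f j. j \<in># mset_set J #}"
proof -
  have c: "card J > 0" using assms by (simp add: card_gt_0_iff)
  have "q * real (card J) \<le> real (card J)" using assms by (simp add: mult_left_le_one_le)
  then have "\<lceil>q * real (card J)\<rceil> \<le> int (card J)" by (simp add: ceiling_le_iff)
  moreover have "int (card {j\<in>J. f j < x}) < \<lceil>q * real (card J)\<rceil>" using assms(5) 
    by (simp add: less_ceiling_iff)
  ultimately have "\<not> nat \<lceil>q * real (card J)\<rceil> - 1 < card {j\<in>J. f j < x}"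
      "nat \<lceil>q * real (card J)\<rceil> - 1 < card J" by linarith+
  then have "\<not> percentile q {# f j. j \<in># mset_set J #} < x"
    unfolding percentile_def
    using assms(1) by (subst sorted_list_of_multiset_nth_iff[where P = "\<lambda>y. y < x"]) auto
  then show ?thesis by simp
qed

text \<open>\<open>card J div 2\<close> is the larger of the two middle positions, counted from 0,
  so a strict majority below \<open>x\<close> covers both.\<close>

lemma median_le:
  assumes "finite J" "card J div 2 < card {j\<in>J. f j \<le> x}"
  shows "median {# f j. j \<in># mset_set J #} \<le> x"
proof -
  let ?l = "sorted_list_of_multiset {# f j. j \<in># mset_set J #}"
  have "card {j\<in>J. f j \<le> x} \<le> card J" using assms(1) by (simp add: card_mono)
  then have c: "card J > 0" "card J div 2 < card J" "(card J - 1) div 2 < card J"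
    "(card J - 1) div 2 < card {j\<in>J. f j \<le> x}"
    using assms(2) by linarith+
  have "?l ! ((card J - 1) div 2) \<le> x" "?l ! (card J div 2) \<le> x"
    using c assms sorted_list_of_multiset_nth_iff[OF assms(1), of _ "\<lambda>y. y \<le> x" f] by auto
  then show ?thesis unfolding median_def using assms(1) by simp
qed

lemma le_median:
  assumes "finite J" "card J div 2 < card {j\<in>J. x \<le> f j}"
  shows "x \<le> median {# f j. j \<in># mset_set J #}"
proof -
  let ?l = "sorted_list_of_multiset {# f j. j \<in># mset_set J #}"
  have "card {j\<in>J. x \<le> f j} + card {j\<in>J. f j < x} = card ({j\<in>J. x \<le> f j} \<union> {j\<in>J. f j < x})"
    using assms(1) by (intro card_Un_disjoint[symmetric]) auto
  also have "{j\<in>J. x \<le> f j} \<union> {j\<in>J. f j < x} = J" by auto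
  finally have e: "card {j\<in>J. x \<le> f j} + card {j\<in>J. f j < x} = card J" .
  then have c: "card J div 2 < card J" "(card J - 1) div 2 < card J"
    "\<not> (card J - 1) div 2 < card {j\<in>J. f j < x}" "\<not> card J div 2 < card {j\<in>J. f j < x}"
    using assms(2) by linarith+
  have "\<not> ?l ! ((card J - 1) div 2) < x" "\<not> ?l ! (card J div 2) < x"
    using c assms sorted_list_of_multiset_nth_iff[OF assms(1), of _ "\<lambda>y. y < x" f] by auto
  then show ?thesis unfolding median_def using assms(1) by simp
qed

text \<open>Only the lower middle element is forced below the mean of the two, hence at least half
  and not a strict majority.\<close>

lemma half_le_card_of_median_le:
  assumes "finite J" "J \<noteq> {}" "median {# f j. j \<in># mset_set J #} \<le> x"
  shows "card J \<le> 2 * card {j\<in>J. f j \<le> x}"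
proof -
  let ?l = "sorted_list_of_multiset {# f j. j \<in># mset_set J #}"
  have c: "card J > 0" using assms by (simp add: card_gt_0_iff)
  have "mset ?l = {# f j. j \<in># mset_set J #}" by simp
  then have "length ?l = size {# f j. j \<in># mset_set J #}" by (metis size_mset)
  then have "length ?l = card J" by simp
  then have "?l ! ((card J - 1) div 2) \<le> ?l ! (card J div 2)"
    using c by (intro sorted_nth_mono) auto
  then have "?l ! ((card J - 1) div 2) \<le> x" using assms(1,3) unfolding median_def by simp
  then have "(card J - 1) div 2 < card {j\<in>J. f j \<le> x}"
    using c sorted_list_of_multiset_nth_iff[OF assms(1), of "(card J - 1) div 2" "\<lambda>y. y \<le> x" f] by auto
  then show ?thesis by linarith
qed

subsection \<open>The \<open>p\<close>-norm\<close>

text \<open>Convexity of the power on the closed half-line. A zero end point is split off; there it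
  reduces to \<open>c powr p \<le> c\<close> for \<open>c\<close> in [0, 1].\<close>

lemma convex_combination_powr_le:
  fixes a b p t :: real
  assumes "1 \<le> p" "0 \<le> a" "0 \<le> b" "0 \<le> t" "t \<le> 1"
  shows "((1 - t) * a + t * b) powr p \<le> (1 - t) * a powr p + t * b powr p"
proof -
  have *: "(c * x) powr p \<le> c * x powr p" if "0 \<le> c" "c \<le> 1" "0 \<le> x" for c x :: real
  proof -
    have "c powr p \<le> c" using that assms(1) powr_mono'[of 1 p c] by simp
    then show ?thesis using that by (simp add: powr_mult mult_right_mono)
  qed
  show ?thesis
  proof (cases "a = 0 \<or> b = 0")
    case True
    then show ?thesis using *[of t b] *[of "1 - t" a] assms by auto
  next
    case False
    then show ?thesis
      using convex_onD[OF powr_convex[OF assms(1)], of t a b] assms by simp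
  qed
qed

lemma pnorm_nonneg [simp]: "0 \<le> pnorm p v"
  by (simp add: pnorm_def)

lemma pnorm_powr: "0 < p \<Longrightarrow> pnorm p v powr p = (\<Sum>j\<in>UNIV. \<bar>v $ j\<bar> powr p)"
  by (simp add: pnorm_def powr_powr sum_nonneg)

lemma pnorm_0 [simp]: "0 < p \<Longrightarrow> pnorm p 0 = 0"
  by (simp add: pnorm_def)

lemma pnorm_eq_0_iff: "0 < p \<Longrightarrow> pnorm p v = 0 \<longleftrightarrow> v = 0"
  by (simp add: pnorm_def powr_eq_0_iff sum_nonneg_eq_0_iff vec_eq_iff)

lemma pnorm_minus: "pnorm p (- v) = pnorm p v"
  by (simp add: pnorm_def)

lemma pnorm_minus_commute: "pnorm p (u - v) = pnorm p (v - u)"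
  using pnorm_minus[of p "u - v"] by simp

text \<open>Minkowski by convexity: \<open>u + v\<close> is \<open>\<alpha> + \<beta>\<close> times
  a convex combination of the two vectors scaled to norm 1. Coordinatewise convexity, summed, bounds
  the p-th power of the norm of that combination by 1.\<close>

lemma pnorm_triangle:
  fixes u v :: "real ^ 'd"
  assumes "1 \<le> p"
  shows "pnorm p (u + v) \<le> pnorm p u + pnorm p v"
proof (cases "u = 0 \<or> v = 0")
  case True
  then show ?thesis using assms by auto
next
  case False
  define \<alpha> \<beta> where "\<alpha> = pnorm p u" and "\<beta> = pnorm p v"
  have pos: "0 < \<alpha>" "0 < \<beta>"
    using False assms pnorm_eq_0_iff[of p u] pnorm_eq_0_iff[of p v]
      pnorm_nonneg[of p u] pnorm_nonneg[of p v] unfolding \<alpha>_def \<beta>_def by linarith+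
  define t where "t = \<beta> / (\<alpha> + \<beta>)"
  have t: "0 \<le> t" "t \<le> 1" "1 - t = \<alpha> / (\<alpha> + \<beta>)" using pos by (auto simp: t_def field_simps)
  have summand: "\<bar>(u + v) $ j\<bar> powr p
      \<le> (\<alpha> + \<beta>) powr p * ((1 - t) * (\<bar>u $ j\<bar> powr p / \<alpha> powr p) + t * (\<bar>v $ j\<bar> powr p / \<beta> powr p))" for j
  proof -
    have "\<bar>(u + v) $ j\<bar> \<le> \<bar>u $ j\<bar> + \<bar>v $ j\<bar>" by simp
    also have "\<dots> = (\<alpha> + \<beta>) * ((1 - t) * (\<bar>u $ j\<bar> / \<alpha>) + t * (\<bar>v $ j\<bar> / \<beta>))"
      using pos t(3) by (simp add: t_def distrib_left)
    finally have "\<bar>(u + v) $ j\<bar> powr p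
        \<le> ((\<alpha> + \<beta>) * ((1 - t) * (\<bar>u $ j\<bar> / \<alpha>) + t * (\<bar>v $ j\<bar> / \<beta>))) powr p"
      using assms by (intro powr_mono2) auto
    also have "\<dots> = (\<alpha> + \<beta>) powr p * ((1 - t) * (\<bar>u $ j\<bar> / \<alpha>) + t * (\<bar>v $ j\<bar> / \<beta>)) powr p"
      using t(1,2) pos by (simp add: powr_mult)
    also have "\<dots> \<le> (\<alpha> + \<beta>) powr p * ((1 - t) * (\<bar>u $ j\<bar> / \<alpha>) powr p + t * (\<bar>v $ j\<bar> / \<beta>) powr p)"
      using t(1,2) pos assms by (intro mult_left_mono convex_combination_powr_le) auto
    finally show ?thesis using pos by (simp add: powr_divide)
  qed
  have "pnorm p (u + v) powr p
      \<le> (\<Sum>j\<in>UNIV. (\<alpha> + \<beta>) powr p *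
            ((1 - t) * (\<bar>u $ j\<bar> powr p / \<alpha> powr p) + t * (\<bar>v $ j\<bar> powr p / \<beta> powr p)))"
    using assms summand by (simp add: pnorm_powr sum_mono)
  also have "\<dots> = (\<alpha> + \<beta>) powr p * ((1 - t) * ((\<Sum>j\<in>UNIV. \<bar>u $ j\<bar> powr p) / \<alpha> powr p)
      + t * ((\<Sum>j\<in>UNIV. \<bar>v $ j\<bar> powr p) / \<beta> powr p))"
    by (simp add: sum_distrib_left sum.distrib sum_divide_distrib distrib_left)
  also have "\<dots> = (\<alpha> + \<beta>) powr p"
  proof -
    have "(\<Sum>j\<in>UNIV. \<bar>u $ j\<bar> powr p) = \<alpha> powr p" "(\<Sum>j\<in>UNIV. \<bar>v $ j\<bar> powr p) = \<beta> powr p"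
      using assms by (simp_all add: \<alpha>_def \<beta>_def pnorm_powr)
    then show ?thesis using pos by simp
  qed
  finally have "pnorm p (u + v) powr p \<le> (\<alpha> + \<beta>) powr p" .
  then show ?thesis
    using assms pos unfolding \<alpha>_def \<beta>_def
    by (metis add_nonneg_nonneg less_le_trans less_numeral_extra(1) not_le pnorm_nonneg powr_less_mono2)
qed

section \<open>Power inequalities in place of the parallelogram identity\<close>

lemma powr_add_le_add_powr:
  fixes a b q :: real
  assumes "0 \<le> a" "0 \<le> b" "0 < q" "q \<le> 1"
  shows "(a + b) powr q \<le> a powr q + b powr q"
proof (cases "a + b = 0")
  case False
  then have w: "0 < a + b" using assms by simp
  \<comment> \<open>A fraction in [0, 1] is at most its power with exponent
    \<open>q \<le> 1\<close>, and the fractions for \<open>c = a\<close> and \<open>c = b\<close>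
    add up to 1.\<close>
  have *: "c / (a + b) * (a + b) powr q \<le> c powr q" if "0 \<le> c" "c \<le> a + b" for c
  proof -
    have "c / (a + b) \<le> (c / (a + b)) powr q"
      using that w assms powr_mono'[of q 1 "c / (a + b)"] by simp
    then show ?thesis
      using that w by (simp add: powr_divide pos_le_divide_eq)
  qed
  have "(a + b) powr q = a / (a + b) * (a + b) powr q + b / (a + b) * (a + b) powr q"
    using w by (simp flip: add_divide_distrib distrib_right)
  then show ?thesis using *[of a] *[of b] assms by simp
qed (use assms in auto)

text \<open>Midpoint concavity of \<open>powr q\<close>, read off from convexity of the inverse
  function \<open>powr (1 / q)\<close>.\<close>

lemma powr_add_powr_le:
  fixes u v q :: real
  assumes "0 \<le> u" "0 \<le> v" "0 < q" "q \<le> 1"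
  shows "u powr q + v powr q \<le> 2 * ((u + v) / 2) powr q"
proof -
  have "((u powr q + v powr q) / 2) powr (1 / q) \<le> (u + v) / 2"
    using convex_combination_powr_le[of "1 / q" "u powr q" "v powr q" "1 / 2"] assms
    by (simp add: powr_powr field_simps)
  then have "(((u powr q + v powr q) / 2) powr (1 / q)) powr q \<le> ((u + v) / 2) powr q"
    using assms by (intro powr_mono2) auto
  then show ?thesis using assms by (simp add: powr_powr)
qed

text \<open>Write \<open>\<bar>z\<bar> powr p\<close> as a power of the square with exponent
  \<open>p / 2 \<le> 1\<close>. Midpoint concavity brings both squares under one power, the
  parallelogram identity evaluates their mean, and subadditivity splits it. The inequality fails for
  \<open>p > 2\<close>, as \<open>x = y = 1\<close> shows.\<close>

lemma abs_powr_parallelogram_le: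
  fixes x y p :: real
  assumes "0 < p" "p \<le> 2"
  shows "\<bar>y + x\<bar> powr p + \<bar>y - x\<bar> powr p \<le> 2 * (\<bar>y\<bar> powr p + \<bar>x\<bar> powr p)"
proof -
  have sq: "\<bar>z\<bar> powr p = (z\<^sup>2) powr (p / 2)" for z :: real
  proof -
    have "z\<^sup>2 = \<bar>z\<bar> powr 2" by (cases "z = 0") simp_all
    then show ?thesis by (simp only: powr_powr) simp
  qed
  have "\<bar>y + x\<bar> powr p + \<bar>y - x\<bar> powr p \<le> 2 * (((y + x)\<^sup>2 + (y - x)\<^sup>2) / 2) powr (p / 2)"
    unfolding sq using assms by (intro powr_add_powr_le) auto
  also have "((y + x)\<^sup>2 + (y - x)\<^sup>2) / 2 = y\<^sup>2 + x\<^sup>2" by (simp add: power2_eq_square field_simps)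
  also have "(y\<^sup>2 + x\<^sup>2) powr (p / 2) \<le> (y\<^sup>2) powr (p / 2) + (x\<^sup>2) powr (p / 2)"
    using assms by (intro powr_add_le_add_powr) auto
  finally show ?thesis unfolding sq by simp
qed

lemma pnorm_parallelogram_le:
  assumes "0 < p" "p \<le> 2"
  shows "pnorm p (u + v) powr p + pnorm p (u - v) powr p \<le> 2 * (pnorm p u powr p + pnorm p v powr p)"
  using sum_mono[OF abs_powr_parallelogram_le[OF assms]] assms(1)
  by (simp add: pnorm_powr sum.distrib flip: sum_distrib_left)

subsection \<open>Finitely supported distributions\<close>

text \<open>Membership in \<open>E\<close> is a Bernoulli variable for each independent draw, so the
  count is binomial and Hoeffding's inequality applies with relative deviation
  \<open>c\<close>.\<close>

lemma prob_count_le: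
  fixes q :: "'b pmf"
  assumes "finite J" "J \<noteq> {}" "0 \<le> c" "a + c \<le> measure_pmf.prob q E"
  shows "measure_pmf.prob (Pi_pmf J d (\<lambda>_. q)) {f. real (card {j\<in>J. f j \<in> E}) \<le> a * real (card J)}
    \<le> exp (- 2 * real (card J) * c\<^sup>2)"
proof -
  let ?\<mu> = "measure_pmf.prob q E" and ?n = "card J"
  have n: "?n > 0" using assms by (simp add: card_gt_0_iff)
  have ber: "map_pmf (\<lambda>x. x \<in> E) q = bernoulli_pmf ?\<mu>"
  proof (rule pmf_eqI)
    fix b
    have "pmf (map_pmf (\<lambda>x. x \<in> E) q) True = ?\<mu>"
      by (simp add: pmf_map vimage_def)
    moreover have "pmf (map_pmf (\<lambda>x. x \<in> E) q) False = 1 - ?\<mu>"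
      by (simp add: pmf_map vimage_def measure_pmf.prob_compl[symmetric] set_diff_eq)
    ultimately show "pmf (map_pmf (\<lambda>x. x \<in> E) q) b = pmf (bernoulli_pmf ?\<mu>) b"
      by (cases b) auto
  qed
  have "binomial_pmf ?n ?\<mu>
      = map_pmf (\<lambda>f. card {j\<in>J. f j}) (Pi_pmf J (d \<in> E) (\<lambda>_. map_pmf (\<lambda>x. x \<in> E) q))"
    unfolding ber using assms(1) by (intro binomial_pmf_altdef') auto
  also have "\<dots> = map_pmf (\<lambda>f. card {j\<in>J. f j \<in> E}) (Pi_pmf J d (\<lambda>_. q))"
    using assms(1) by (subst Pi_pmf_map[where dflt = d]) (auto simp: map_pmf_comp)
  finally have bin: "binomial_pmf ?n ?\<mu> = map_pmf (\<lambda>f. card {j\<in>J. f j \<in> E}) (Pi_pmf J d (\<lambda>_. q))" .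
  interpret binomial_distribution ?n ?\<mu> by unfold_locales auto
  have "measure_pmf.prob (Pi_pmf J d (\<lambda>_. q)) {f. real (card {j\<in>J. f j \<in> E}) \<le> a * real ?n}
      = measure_pmf.prob (binomial_pmf ?n ?\<mu>) {x. real x \<le> a * real ?n}"
    by (simp add: bin vimage_def)
  also have "\<dots> \<le> measure_pmf.prob (binomial_pmf ?n ?\<mu>) {x. real x / real ?n \<le> ?\<mu> - c}"
    using n assms(4) by (intro measure_pmf.finite_measure_mono) (auto simp: pos_divide_le_eq intro: order_trans mult_right_mono)
  also have "\<dots> \<le> exp (- 2 * real ?n * c\<^sup>2)"
    using prob_le'[OF n assms(3)] by simp
  finally show ?thesis .
qed

text \<open>There may be an atom at the quantile, so two one-sided bounds replace an exact mass
  \<open>u\<close>. The witness is the least attained value whose lower tail has mass at least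
  \<open>u\<close>.\<close>

lemma exists_quantile:
  fixes f :: "'a \<Rightarrow> real"
  assumes "finite (set_pmf Q)" "0 \<le> u" "u \<le> 1"
  obtains q where "u \<le> measure_pmf.prob Q {x. f x \<le> q}" "measure_pmf.prob Q {x. f x < q} \<le> u"
proof -
  define V where "V = {v \<in> f ` set_pmf Q. u \<le> measure_pmf.prob Q {x. f x \<le> v}}"
  have fin: "finite (f ` set_pmf Q)" using assms by simp
  have ne: "f ` set_pmf Q \<noteq> {}" by (simp add: set_pmf_not_empty)
  have "measure_pmf.prob Q {x. f x \<le> Max (f ` set_pmf Q)} = 1"
    using fin by (subst measure_pmf.prob_eq_1) (auto simp: AE_measure_pmf_iff)
  then have "Max (f ` set_pmf Q) \<in> V" using assms(3) Max_in[OF fin ne] by (simp add: V_def)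
  then have V: "finite V" "V \<noteq> {}"
    using fin unfolding V_def by auto
  show ?thesis
  proof
    show "u \<le> measure_pmf.prob Q {x. f x \<le> Min V}" using Min_in[OF V] by (simp add: V_def)
    \<comment> \<open>The attained values below \<open>Min V\<close>. The largest of them has almost
      surely the same lower tail as the event \<open>f x < Min V\<close>, and its absence from
      \<open>V\<close> bounds that mass by \<open>u\<close>.\<close>
    define W where "W = {v \<in> f ` set_pmf Q. v < Min V}"
    show "measure_pmf.prob Q {x. f x < Min V} \<le> u"
    proof (cases "W = {}")
      case True
      then have "measure_pmf.prob Q {x. f x < Min V} = 0"
        by (subst measure_pmf.prob_eq_0) (auto simp: AE_measure_pmf_iff W_def)
      then show ?thesis using assms(2) by simp
    next
      case False
      have W: "finite W" using fin by (simp add: W_def)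
      have "measure_pmf.prob Q {x. f x < Min V} \<le> measure_pmf.prob Q {x. f x \<le> Max W}"
        using W by (intro measure_pmf.finite_measure_mono_AE) (auto simp: AE_measure_pmf_iff W_def)
      also have "\<dots> \<le> u"
      proof -
        have "Max W \<in> W" using W False by simp
        then have "Max W \<in> f ` set_pmf Q" "Max W < Min V" by (auto simp: W_def)
        moreover from this(2) have "Max W \<notin> V" using V Min_le[of V "Max W"] by (meson not_le)
        ultimately show ?thesis unfolding V_def by auto
      qed
      finally show ?thesis by simp
    qed
  qed
qed

lemma finite_set_Pi_pmf:
  assumes "finite A" "\<And>x. x \<in> A \<Longrightarrow> finite (set_pmf (p x))"
  shows "finite (set_pmf (Pi_pmf A d p))"
  using assms by (auto simp: set_Pi_pmf intro!: finite_PiE_dflt)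

lemma expectation_pair_pmf_finite:
  fixes f :: "'a \<times> 'b \<Rightarrow> real"
  assumes "finite (set_pmf P)" "finite (set_pmf Q)"
  shows "measure_pmf.expectation (pair_pmf P Q) f
    = measure_pmf.expectation P (\<lambda>x. measure_pmf.expectation Q (\<lambda>y. f (x, y)))"
proof -
  have "pair_pmf P Q = P \<bind> (\<lambda>x. map_pmf (Pair x) Q)"
    by (simp add: pair_pmf_def map_pmf_def)
  then show ?thesis
    using assms by (simp add: pmf_expectation_bind[of "set_pmf P"] integral_measure_pmf[of "set_pmf P"])
qed

subsection \<open>One repetition of the sketch\<close>

definition column_pmf :: "nat \<Rightarrow> (('n::finite \<Rightarrow> nat) \<times> ('n \<Rightarrow> real)) pmf" where
  "column_pmf r = pair_pmf (Pi_pmf UNIV 1 (\<lambda>_. pmf_of_set {1..r})) (Pi_pmf UNIV 1 (\<lambda>_. pmf_of_set {-1, 1}))"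

definition coin_columns :: "'n coins \<Rightarrow> nat \<Rightarrow> ('n \<Rightarrow> nat) \<times> ('n \<Rightarrow> real)" where
  "coin_columns \<omega> = (case \<omega> of (h, \<sigma>) \<Rightarrow> \<lambda>j. (\<lambda>i. h (i, j), \<lambda>i. \<sigma> (i, j)))"

text \<open>Grouping the coins by repetition gives independent, identically distributed columns. As
  \<open>coin_columns\<close> is bijective, point masses can be compared: both factor over the pairs
  \<open>(i, j)\<close>, and both vanish unless all repetitions outside \<open>{1..s}\<close> carry
  the default.\<close>

lemma map_coin_columns_coins_pmf:
  "map_pmf coin_columns (coins_pmf s r :: 'n::finite coins pmf)
    = Pi_pmf {1..s} (\<lambda>_. 1, \<lambda>_. 1) (\<lambda>_. column_pmf r)"
proof (rule pmf_eqI)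
  fix c :: "nat \<Rightarrow> ('n \<Rightarrow> nat) \<times> ('n \<Rightarrow> real)"
  define \<omega> :: "'n coins" where "\<omega> = (\<lambda>(i, j). fst (c j) i, \<lambda>(i, j). snd (c j) i)"
  have c: "c = coin_columns \<omega>" by (simp add: \<omega>_def coin_columns_def)
  have inj: "inj (coin_columns :: 'n coins \<Rightarrow> _)"
    by (auto simp: inj_def coin_columns_def fun_eq_iff)
  have outside: "(\<forall>x. x \<notin> {1..s} \<longrightarrow> c x = (\<lambda>_. 1, \<lambda>_. 1)) \<longleftrightarrow>
      (\<forall>x. x \<notin> UNIV \<times> {1..s} \<longrightarrow> fst \<omega> x = 1) \<and> (\<forall>x. x \<notin> UNIV \<times> {1..s} \<longrightarrow> snd \<omega> x = 1)"
    by (auto simp: \<omega>_def fun_eq_iff prod_eq_iff)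
  have swap: "(\<Prod>x\<in>UNIV \<times> {1..s}. g x) = (\<Prod>j\<in>{1..s}. \<Prod>i\<in>UNIV. g (i, j))"
    for g :: "'n \<times> nat \<Rightarrow> real"
    by (subst prod.swap) (simp add: prod.cartesian_product)
  have "pmf (map_pmf coin_columns (coins_pmf s r)) c = pmf (coins_pmf s r) (fst \<omega>, snd \<omega>)"
    using inj by (simp add: c pmf_map_inj')
  also have "\<dots> = pmf (Pi_pmf {1..s} (\<lambda>_. 1, \<lambda>_. 1) (\<lambda>_. column_pmf r)) c"
  proof (cases "\<forall>x. x \<notin> {1..s} \<longrightarrow> c x = (\<lambda>_. 1, \<lambda>_. 1)")
    case True
    have "pmf (column_pmf r) (c j) = (\<Prod>i\<in>UNIV. pmf (pmf_of_set {1..r}) (fst \<omega> (i, j)))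
        * (\<Prod>i\<in>UNIV. pmf (pmf_of_set {-1, 1}) (snd \<omega> (i, j)))" for j
      by (cases "c j") (simp add: column_pmf_def pmf_pair pmf_Pi \<omega>_def)
    moreover have "pmf (Pi_pmf (UNIV \<times> {1..s}) 1 (\<lambda>_. pmf_of_set {1..r})) (fst \<omega>)
        = (\<Prod>x\<in>UNIV \<times> {1..s}. pmf (pmf_of_set {1..r}) (fst \<omega> x))"
      "pmf (Pi_pmf (UNIV \<times> {1..s}) 1 (\<lambda>_. pmf_of_set {-1, 1})) (snd \<omega>)
        = (\<Prod>x\<in>UNIV \<times> {1..s}. pmf (pmf_of_set {-1, 1}) (snd \<omega> x))"
      "pmf (Pi_pmf {1..s} (\<lambda>_. 1, \<lambda>_. 1) (\<lambda>_. column_pmf r)) c = (\<Prod>j\<in>{1..s}. pmf (column_pmf r) (c j))"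
      using True iffD1[OF outside True]
      by (simp_all only: pmf_Pi' finite_atLeastAtMost finite_SigmaI finite simp_thms)
    ultimately show ?thesis
      unfolding coins_pmf_def pmf_pair by (simp only: swap prod.distrib)
  next
    case False
    then have "\<not> (\<forall>x. x \<notin> UNIV \<times> {1..s} \<longrightarrow> fst \<omega> x = 1) \<or> \<not> (\<forall>x. x \<notin> UNIV \<times> {1..s} \<longrightarrow> snd \<omega> x = 1)"
      using outside by blast
    then have "pmf (Pi_pmf (UNIV \<times> {1..s}) 1 (\<lambda>_. pmf_of_set {1..r})) (fst \<omega>) = 0
        \<or> pmf (Pi_pmf (UNIV \<times> {1..s}) 1 (\<lambda>_. pmf_of_set {-1, 1})) (snd \<omega>) = 0"
    proof (elim disj_forward)
      assume "\<not> (\<forall>x. x \<notin> UNIV \<times> {1..s} \<longrightarrow> fst \<omega> x = 1)"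
      then show "pmf (Pi_pmf (UNIV \<times> {1..s}) 1 (\<lambda>_. pmf_of_set {1..r})) (fst \<omega>) = 0"
        by (intro pmf_Pi_outside) (simp, blast)
    next
      assume "\<not> (\<forall>x. x \<notin> UNIV \<times> {1..s} \<longrightarrow> snd \<omega> x = 1)"
      then show "pmf (Pi_pmf (UNIV \<times> {1..s}) 1 (\<lambda>_. pmf_of_set {-1, 1})) (snd \<omega>) = 0"
        by (intro pmf_Pi_outside) (simp, blast)
    qed
    moreover have "pmf (Pi_pmf {1..s} (\<lambda>_. 1, \<lambda>_. 1) (\<lambda>_. column_pmf r)) c = 0"
      using False by (intro pmf_Pi_outside) auto
    ultimately show ?thesis
      unfolding coins_pmf_def pmf_pair by auto
  qed
  finally show "pmf (map_pmf coin_columns (coins_pmf s r)) c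
      = pmf (Pi_pmf {1..s} (\<lambda>_. 1, \<lambda>_. 1) (\<lambda>_. column_pmf r)) c" .
qed

lemma prob_coins_pmf_columns:
  "measure_pmf.prob (coins_pmf s r :: 'n::finite coins pmf) {\<omega>. P (coin_columns \<omega>)}
    = measure_pmf.prob (Pi_pmf {1..s} (\<lambda>_. 1, \<lambda>_. 1) (\<lambda>_. column_pmf r)) {c. P c}"
  unfolding map_coin_columns_coins_pmf[symmetric] by (simp add: vimage_def)

text \<open>Induction on \<open>T\<close> with \<open>v\<close> free: the sign of \<open>x\<close>
  moves the offset to \<open>v - b x\<close> or \<open>v + b x\<close> with equal probability, and
  the parallelogram inequality merges the two back into \<open>v\<close> at the cost of the single
  term for \<open>b x\<close>.\<close>

lemma expectation_signed_sum_le: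
  fixes b :: "'k \<Rightarrow> real ^ 'd"
  assumes "finite T" "0 < p" "p \<le> 2"
  shows "measure_pmf.expectation (Pi_pmf T e (\<lambda>_. pmf_of_set {-1, 1}))
      (\<lambda>\<sigma>. pnorm p (v + (\<Sum>k\<in>T. \<sigma> k *\<^sub>R b k)) powr p)
    \<le> pnorm p v powr p + (\<Sum>k\<in>T. pnorm p (b k) powr p)"
  using assms(1)
proof (induction T arbitrary: v)
  case (insert x T)
  let ?P = "Pi_pmf T e (\<lambda>_. pmf_of_set {-1, 1 :: real})"
  let ?E = "\<lambda>v. measure_pmf.expectation ?P (\<lambda>\<sigma>. pnorm p (v + (\<Sum>k\<in>T. \<sigma> k *\<^sub>R b k)) powr p)"
  let ?f = "\<lambda>\<sigma>. pnorm p (v + (\<Sum>k\<in>insert x T. \<sigma> k *\<^sub>R b k)) powr p"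
  have fin: "finite (set_pmf ?P)"
    using insert by (auto simp: set_Pi_pmf intro!: finite_PiE_dflt)
  have upd: "measure_pmf.expectation (?P \<bind> (\<lambda>f. return_pmf (f(x := y)))) ?f = ?E (v + y *\<^sub>R b x)" for y
  proof -
    have "(\<Sum>k\<in>insert x T. (f(x := y)) k *\<^sub>R b k) = y *\<^sub>R b x + (\<Sum>k\<in>T. f k *\<^sub>R b k)" for f
      using insert by (subst sum.insert) (auto intro!: sum.cong)
    then show ?thesis
      unfolding map_pmf_def[symmetric] by (simp add: integral_map_pmf add.assoc)
  qed
  have "measure_pmf.expectation (Pi_pmf (insert x T) e (\<lambda>_. pmf_of_set {-1, 1})) ?f
      = (?E (v - b x) + ?E (v + b x)) / 2"
    unfolding Pi_pmf_insert'[OF insert(1,2)]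
    by (subst pmf_expectation_bind_pmf_of_set) (use fin in \<open>auto simp: upd[simplified] upd[of "-1", simplified] upd[of "1", simplified]\<close>)
  also have "\<dots> \<le> (pnorm p (v - b x) powr p + pnorm p (v + b x) powr p) / 2
      + (\<Sum>k\<in>T. pnorm p (b k) powr p)"
    using insert.IH[of "v - b x"] insert.IH[of "v + b x"] by (simp add: field_simps)
  also have "\<dots> \<le> pnorm p v powr p + pnorm p (b x) powr p + (\<Sum>k\<in>T. pnorm p (b k) powr p)"
    using pnorm_parallelogram_le[OF assms(2,3), of v "b x"] by simp
  finally show ?case using insert by simp
qed simp

section \<open>Bucket contents and row errors in one repetition\<close>

definition bucket_sum :: "('n::finite \<Rightarrow> real ^ 'd) \<Rightarrow> ('n \<Rightarrow> nat) \<times> ('n \<Rightarrow> real) \<Rightarrow> nat \<Rightarrow> real ^ 'd" where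
  "bucket_sum a c b = (\<Sum>k | fst c k = b. snd c k *\<^sub>R a k)"

definition row_error :: "('n::finite \<Rightarrow> real ^ 'd) \<Rightarrow> 'n \<Rightarrow> ('n \<Rightarrow> nat) \<times> ('n \<Rightarrow> real) \<Rightarrow> real ^ 'd" where
  "row_error a i c = snd c i *\<^sub>R bucket_sum a c (fst c i) - a i"

lemma finite_set_column_pmf: "0 < r \<Longrightarrow> finite (set_pmf (column_pmf r))"
  by (simp add: column_pmf_def finite_set_Pi_pmf)

lemma prob_Pi_pmf_bucket:
  assumes "0 < r"
  shows "measure_pmf.prob (Pi_pmf UNIV d (\<lambda>_. pmf_of_set {1..r})) {h. h (k :: 'n::finite) = 1} = 1 / real r"
proof -
  have "measure_pmf.prob (Pi_pmf UNIV d (\<lambda>_. pmf_of_set {1..r})) {h. h k = 1}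
      = measure_pmf.prob (map_pmf (\<lambda>h. h k) (Pi_pmf UNIV d (\<lambda>_. pmf_of_set {1..r}))) {1}"
    by (simp add: vimage_def)
  also have "\<dots> = 1 / real r"
    using assms by (simp add: Pi_pmf_component measure_pmf_single)
  finally show ?thesis .
qed

lemma prob_column_bucket:
  assumes "0 < r"
  shows "measure_pmf.prob (column_pmf r) {c. fst c (k :: 'n::finite) = 1} = 1 / real r"
proof -
  have "measure_pmf.prob (column_pmf r) {c. fst c k = 1}
      = measure_pmf.prob (map_pmf fst (column_pmf r :: (('n \<Rightarrow> nat) \<times> ('n \<Rightarrow> real)) pmf)) {h. h k = 1}"
    by (simp add: vimage_def)
  then show ?thesis
    by (simp only: column_pmf_def map_fst_pair_pmf prob_Pi_pmf_bucket[OF assms])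
qed

text \<open>Given the hash values, the sign bound with offset 0 applies to the rows in bucket 1;
  each row lands there with probability \<open>1 / real r\<close>.\<close>

lemma expectation_bucket_sum_le:
  fixes a :: "'n::finite \<Rightarrow> real ^ 'd"
  assumes "1 \<le> p" "p \<le> 2" "0 < r"
  shows "measure_pmf.expectation (column_pmf r)
      (\<lambda>c. pnorm p (bucket_sum (\<lambda>k. if k \<in> S then a k else 0) c 1) powr p)
    \<le> (\<Sum>k\<in>S. pnorm p (a k) powr p) / real r"
proof -
  let ?H = "Pi_pmf UNIV 1 (\<lambda>_ :: 'n. pmf_of_set {1..r})"
  let ?\<Sigma> = "Pi_pmf UNIV 1 (\<lambda>_ :: 'n. pmf_of_set {-1, 1 :: real})"
  let ?a = "\<lambda>k. if k \<in> S then a k else 0"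
  have fin: "finite (set_pmf ?H)" "finite (set_pmf ?\<Sigma>)"
    using assms(3) by (simp_all add: finite_set_Pi_pmf)
  \<comment> \<open>Rows outside bucket 1 become zero vectors, so the index set no longer depends on
    \<open>h\<close>; the leading \<open>0\<close> is the offset in
    \<open>expectation_signed_sum_le\<close>.\<close>
  have bs: "bucket_sum ?a (h, \<sigma>) 1
      = 0 + (\<Sum>k\<in>UNIV. \<sigma> k *\<^sub>R (if h k = 1 then ?a k else 0))" for h \<sigma>
    by (simp add: bucket_sum_def sum.If_cases if_distrib[where f = "\<lambda>x. _ *\<^sub>R x"] cong: if_cong)
  have "measure_pmf.expectation (column_pmf r) (\<lambda>c. pnorm p (bucket_sum ?a c 1) powr p)
      = measure_pmf.expectation ?H (\<lambda>h. measure_pmf.expectation ?\<Sigma>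
          (\<lambda>\<sigma>. pnorm p (bucket_sum ?a (h, \<sigma>) 1) powr p))"
    unfolding column_pmf_def using fin by (rule expectation_pair_pmf_finite)
  also have "\<dots> \<le> measure_pmf.expectation ?H (\<lambda>h. \<Sum>k\<in>S. pnorm p (a k) powr p * indicator {h. h k = 1} h)"
  proof (intro integral_mono integrable_measure_pmf_finite fin)
    fix h :: "'n \<Rightarrow> nat"
    have "measure_pmf.expectation ?\<Sigma> (\<lambda>\<sigma>. pnorm p (bucket_sum ?a (h, \<sigma>) 1) powr p)
        \<le> pnorm p (0 :: real ^ 'd) powr p + (\<Sum>k\<in>UNIV. pnorm p (if h k = 1 then ?a k else 0) powr p)"
      unfolding bs using assms by (intro expectation_signed_sum_le) auto
    also have "\<dots> = (\<Sum>k\<in>S. pnorm p (if h k = 1 then a k else 0) powr p)"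
      using assms(1) by (subst sum.mono_neutral_right[of UNIV S]) (auto intro!: sum.cong)
    also have "\<dots> = (\<Sum>k\<in>S. pnorm p (a k) powr p * indicator {h. h k = 1} h)"
      using assms(1) by (intro sum.cong) auto
    finally show "measure_pmf.expectation ?\<Sigma> (\<lambda>\<sigma>. pnorm p (bucket_sum ?a (h, \<sigma>) 1) powr p)
        \<le> (\<Sum>k\<in>S. pnorm p (a k) powr p * indicator {h. h k = 1} h)" .
  qed
  also have "\<dots> = (\<Sum>k\<in>S. pnorm p (a k) powr p * measure_pmf.prob ?H {h. h k = 1})"
    using assms(3) by (subst Bochner_Integration.integral_sum)
      (auto simp del: sum_mult_indicator intro!: integrable_measure_pmf_finite finite_set_Pi_pmf sum.cong)
  also have "\<dots> = (\<Sum>k\<in>S. pnorm p (a k) powr p) / real r"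
    by (simp only: prob_Pi_pmf_bucket[OF assms(3)] sum_divide_distrib) simp
  finally show ?thesis .
qed

text \<open>There are two ways to fail: a row outside \<open>S\<close> falls into bucket 1 (union
  bound), or the rows of \<open>S\<close> alone exceed \<open>K\<close> times the bound on their
  expectation (Markov).\<close>

lemma prob_bucket_sum_le:
  fixes a :: "'n::finite \<Rightarrow> real ^ 'd"
  assumes "1 \<le> p" "p \<le> 2" "0 < r" "0 < K"
  shows "1 - real (card (- S)) / real r - 1 / K \<le> measure_pmf.prob (column_pmf r)
    {c. pnorm p (bucket_sum a c 1) powr p \<le> K * (\<Sum>k\<in>S. pnorm p (a k) powr p) / real r}"
proof -
  let ?P = "column_pmf r :: (('n \<Rightarrow> nat) \<times> ('n \<Rightarrow> real)) pmf"
  let ?N = "\<Sum>k\<in>S. pnorm p (a k) powr p"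
  let ?a = "\<lambda>k. if k \<in> S then a k else 0"
  let ?Y = "\<lambda>c. pnorm p (bucket_sum ?a c 1) powr p"
  let ?G = "{c. pnorm p (bucket_sum a c 1) powr p \<le> K * ?N / real r}"
  have N: "0 \<le> ?N" by (simp add: sum_nonneg)
  have markov: "measure_pmf.prob ?P {c. K * ?N / real r < ?Y c} \<le> 1 / K"
  \<comment> \<open>Markov's inequality needs a positive threshold; if \<open>?N = 0\<close>, all
    rows of \<open>S\<close> vanish and the event is empty.\<close>
  proof (cases "?N = 0")
    case True
    then have "?a k = 0" for k
      using assms(1) by (auto simp: sum_nonneg_eq_0_iff pnorm_eq_0_iff)
    then have "bucket_sum ?a c 1 = 0" for c unfolding bucket_sum_def by simp
    then show ?thesis using True assms by simp
  next
    case False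
    then have pos: "0 < K * ?N / real r" using N assms by simp
    have "measure_pmf.prob ?P {c. K * ?N / real r < ?Y c} \<le> measure_pmf.prob ?P {c \<in> space ?P. K * ?N / real r \<le> ?Y c}"
      by (intro measure_pmf.finite_measure_mono) auto
    also have "\<dots> \<le> measure_pmf.expectation ?P ?Y / (K * ?N / real r)"
      using pos by (intro integral_Markov_inequality_measure[where A = "{}"])
        (auto intro!: integrable_measure_pmf_finite finite_set_column_pmf assms)
    also have "\<dots> \<le> (?N / real r) / (K * ?N / real r)"
      using pos expectation_bucket_sum_le[OF assms(1-3)] by (intro divide_right_mono) auto
    also have "\<dots> = 1 / K" using False assms by simp
    finally show ?thesis .
  qed
  have "- ?G \<subseteq> (\<Union>k\<in>- S. {c. fst c k = 1}) \<union> {c. K * ?N / real r < ?Y c}"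
  proof
    fix c assume c: "c \<in> - ?G"
    show "c \<in> (\<Union>k\<in>- S. {c. fst c k = 1}) \<union> {c. K * ?N / real r < ?Y c}"
    proof (cases "\<exists>k\<in>- S. fst c k = 1")
      case False
      then have "bucket_sum ?a c 1 = bucket_sum a c 1"
        unfolding bucket_sum_def by (intro sum.cong) auto
      then show ?thesis using c by auto
    qed auto
  qed
  then have "measure_pmf.prob ?P (- ?G)
      \<le> measure_pmf.prob ?P ((\<Union>k\<in>- S. {c. fst c k = 1}) \<union> {c. K * ?N / real r < ?Y c})"
    by (intro measure_pmf.finite_measure_mono) auto
  also have "\<dots> \<le> measure_pmf.prob ?P (\<Union>k\<in>- S. {c. fst c k = 1})
      + measure_pmf.prob ?P {c. K * ?N / real r < ?Y c}"
    by (intro measure_Un_le) auto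
  also have "measure_pmf.prob ?P (\<Union>k\<in>- S. {c. fst c k = 1})
      \<le> (\<Sum>k\<in>- S. measure_pmf.prob ?P {c. fst c k = 1})"
    by (intro measure_pmf.finite_measure_subadditive_finite) auto
  also have "\<dots> = real (card (- S)) / real r"
    using assms by (simp only: prob_column_bucket) simp
  finally have "measure_pmf.prob ?P (- ?G) \<le> real (card (- S)) / real r + 1 / K"
    using markov by simp
  moreover have "measure_pmf.prob ?P (- ?G) = 1 - measure_pmf.prob ?P ?G"
    using measure_pmf.prob_compl[of ?G ?P] by (simp add: Compl_eq_Diff_UNIV)
  ultimately show ?thesis by linarith
qed

text \<open>Take row \<open>i\<close> out and draw its bucket \<open>b\<close> separately. Its own
  contribution to bucket \<open>b\<close> cancels against \<open>a i\<close>, so the error is, up to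
  sign, the content of bucket \<open>b\<close> without row \<open>i\<close>; evenness of
  \<open>P\<close> disposes of the sign, and symmetry allows bucket 1 in place of \<open>b\<close>.
  The full bucket 1 differs only if \<open>b = 1\<close>, which costs
  \<open>1 / real r\<close>.\<close>

lemma prob_row_error_ge:
  fixes a :: "'n::finite \<Rightarrow> real ^ 'd"
  assumes "0 < r" and even: "\<And>v. P (- v) \<longleftrightarrow> P v"
  shows "measure_pmf.prob (column_pmf r) {c. P (bucket_sum a c 1)} - 1 / real r
    \<le> measure_pmf.prob (column_pmf r) {c. P (row_error a i c)}"
proof -
  let ?u = "pmf_of_set {1..r}"
  let ?\<Sigma> = "Pi_pmf UNIV 1 (\<lambda>_ :: 'n. pmf_of_set {-1, 1 :: real})"
  txt \<open>The default bucket \<open>0\<close> is not a real bucket, so under \<open>D\<close> row \<open>i\<close> is in none of the buckets \<open>1, \<dots>, r\<close>.\<close>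
  define D where "D = Pi_pmf (UNIV - {i}) 0 (\<lambda>_. ?u)"
  define Q where "Q = pair_pmf D ?\<Sigma>"
  define upd where "upd = (\<lambda>b c. ((fst c)(i := b), snd c) :: ('n \<Rightarrow> nat) \<times> ('n \<Rightarrow> real))"
  \<comment> \<open>No argument lies outside \<open>UNIV\<close>, so point masses agree for the
    defaults 1 and 0; the latter is the one used in \<open>D\<close>.\<close>
  have "Pi_pmf UNIV 1 (\<lambda>_. ?u) = Pi_pmf (insert i (UNIV - {i})) 0 (\<lambda>_. ?u)"
    by (intro pmf_eqI) (simp add: pmf_Pi insert_absorb)
  also have "\<dots> = map_pmf (\<lambda>(b, g). g(i := b)) (pair_pmf ?u D)"
    unfolding D_def by (rule Pi_pmf_insert) auto
  finally have "column_pmf r = pair_pmf (map_pmf (\<lambda>(b, g). g(i := b)) (pair_pmf ?u D)) ?\<Sigma>"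
    by (simp add: column_pmf_def)
  then have col: "column_pmf r = map_pmf (\<lambda>(b, c). upd b c) (pair_pmf ?u Q)"
    by (simp add: pair_map_pmf1 pair_pair_pmf map_pmf_comp Q_def upd_def apfst_def case_prod_unfold)
  have Q: "fst c i = 0" "snd c i \<in> {-1, 1}" if "c \<in> set_pmf Q" for c
    using that by (auto simp: Q_def D_def set_Pi_pmf PiE_dflt_def)
  have sym: "map_pmf (\<lambda>c. P (bucket_sum a c b)) Q = map_pmf (\<lambda>c. P (bucket_sum a c 1)) Q"
    if "b \<in> {1..r}" for b
  proof -
    \<comment> \<open>Swapping buckets 1 and \<open>b\<close> preserves the uniform law and fixes
      the default 0, hence preserves \<open>D\<close>, while it exchanges the contents of the two
      buckets.\<close>
    let ?t = "Transposition.transpose 1 b"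
    have "map_pmf ?t ?u = ?u"
    proof (rule map_pmf_of_set_bij_betw)
      show "bij_betw ?t {1..r} {1..r}"
        using that assms(1) by (intro bij_betwI[where g = ?t]) (auto simp: Transposition.transpose_def)
    qed (use that in auto)
    moreover have "?t 0 = 0" using that by (simp add: Transposition.transpose_def)
    ultimately have D_inv: "map_pmf (\<lambda>g. ?t \<circ> g) D = D"
      unfolding D_def using Pi_pmf_map[of "UNIV - {i}" ?t 0 0 "\<lambda>_. ?u"] by simp
    have "map_pmf (\<lambda>(g, \<sigma>). (?t \<circ> g, \<sigma>)) Q = Q"
      using map_pair[of "\<lambda>g. ?t \<circ> g" "\<lambda>\<sigma>. \<sigma>" D ?\<Sigma>] by (simp only: Q_def D_inv map_pmf_ident)
    then have "map_pmf (\<lambda>c. P (bucket_sum a c b)) Q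
        = map_pmf (\<lambda>c. P (bucket_sum a c b)) (map_pmf (\<lambda>(g, \<sigma>). (?t \<circ> g, \<sigma>)) Q)" by (simp only:)
    also have "\<dots> = map_pmf (\<lambda>c. P (bucket_sum a c 1)) Q"
    proof -
      have "?t (g k) = b \<longleftrightarrow> g k = 1" for g :: "'n \<Rightarrow> nat" and k
        by (auto simp: Transposition.transpose_def split: if_splits)
      then show ?thesis by (simp add: map_pmf_comp split_beta bucket_sum_def)
    qed
    finally show ?thesis .
  qed
  have "map_pmf (\<lambda>c. P (row_error a i c)) (column_pmf r)
      = ?u \<bind> (\<lambda>b. map_pmf (\<lambda>c. P (row_error a i (upd b c))) Q)"
    unfolding col by (simp add: pair_pmf_def map_pmf_def bind_assoc_pmf bind_return_pmf)
  also have "\<dots> = ?u \<bind> (\<lambda>b. map_pmf (\<lambda>c. P (bucket_sum a c 1)) Q)"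
  proof (intro bind_pmf_cong refl)
    fix b assume "b \<in> set_pmf ?u"
    then have b: "b \<in> {1..r}" using assms(1) by simp
    have "P (row_error a i (upd b c)) \<longleftrightarrow> P (bucket_sum a c b)" if "c \<in> set_pmf Q" for c
    proof -
      \<comment> \<open>Under \<open>Q\<close> row \<open>i\<close> sits in bucket 0, so
        \<open>upd\<close> adds exactly this row to bucket \<open>b\<close>; the square of its sign
        is 1.\<close>
      have "{k. ((fst c)(i := b)) k = b} = insert i {k. fst c k = b}" by auto
      then have "bucket_sum a (upd b c) b = snd c i *\<^sub>R a i + bucket_sum a c b"
        using Q(1)[OF that] b by (simp add: bucket_sum_def upd_def)
      then have "row_error a i (upd b c) = snd c i *\<^sub>R bucket_sum a c b"
        using Q(2)[OF that] by (auto simp: row_error_def upd_def)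
      then show ?thesis using Q(2)[OF that] even[of "bucket_sum a c b"] by auto
    qed
    then have "map_pmf (\<lambda>c. P (row_error a i (upd b c))) Q = map_pmf (\<lambda>c. P (bucket_sum a c b)) Q"
      by (intro map_pmf_cong) auto
    then show "map_pmf (\<lambda>c. P (row_error a i (upd b c))) Q = map_pmf (\<lambda>c. P (bucket_sum a c 1)) Q"
      using sym[OF b] by simp
  qed
  finally have "map_pmf (\<lambda>c. P (row_error a i c)) (column_pmf r) = map_pmf (\<lambda>c. P (bucket_sum a c 1)) Q"
    by simp
  then have "measure_pmf.prob (map_pmf (\<lambda>c. P (row_error a i c)) (column_pmf r)) {True}
      = measure_pmf.prob (map_pmf (\<lambda>c. P (bucket_sum a c 1)) Q) {True}" by simp
  then have err: "measure_pmf.prob (column_pmf r) {c. P (row_error a i c)}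
      = measure_pmf.prob Q {c. P (bucket_sum a c 1)}" by (simp add: vimage_def)
  have "bucket_sum a (upd b c) 1 = bucket_sum a c 1" if "c \<in> set_pmf Q" "b \<noteq> 1" for b c
  proof -
    have "{k. ((fst c)(i := b)) k = 1} = {k. fst c k = 1}" using that Q(1)[OF that(1)] by auto
    then show ?thesis by (simp add: bucket_sum_def upd_def)
  qed
  then have "measure_pmf.prob (column_pmf r) {c. P (bucket_sum a c 1)}
      \<le> measure_pmf.prob (pair_pmf ?u Q) ({x. fst x = 1} \<union> {x. P (bucket_sum a (snd x) 1)})"
    unfolding col measure_map_pmf
    by (intro measure_pmf.finite_measure_mono_AE) (auto simp: AE_measure_pmf_iff, metis)
  also have "\<dots> \<le> measure_pmf.prob (pair_pmf ?u Q) {x. fst x = 1}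
      + measure_pmf.prob (pair_pmf ?u Q) {x. P (bucket_sum a (snd x) 1)}"
    by (intro measure_Un_le) auto
  also have "measure_pmf.prob (pair_pmf ?u Q) {x. fst x = 1} = measure_pmf.prob (map_pmf fst (pair_pmf ?u Q)) {1}"
    by (simp add: vimage_def)
  also have "\<dots> = 1 / real r"
    using assms(1) by (simp add: map_fst_pair_pmf measure_pmf_single)
  also have "measure_pmf.prob (pair_pmf ?u Q) {x. P (bucket_sum a (snd x) 1)}
      = measure_pmf.prob (map_pmf snd (pair_pmf ?u Q)) {c. P (bucket_sum a c 1)}"
    by (simp add: vimage_def)
  also have "\<dots> = measure_pmf.prob (column_pmf r) {c. P (row_error a i c)}"
    by (simp add: map_snd_pair_pmf err)
  finally show ?thesis by linarith
qed

subsection \<open>Correctness of the output\<close>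

text \<open>A good repetition has a strict majority within \<open>2 * m\<close>, so the minimal
  spread is at most \<open>(2 * m) powr p\<close>, and at least half of the repetitions lie within
  \<open>2 * m\<close> of \<open>y k\<close>. Half and a strict majority cannot be disjoint, so one
  of these is good; the triangle inequality adds its \<open>m\<close>.\<close>

lemma arg_min_spread_close:
  fixes y :: "nat \<Rightarrow> real ^ 'd"
  assumes "1 \<le> p" "finite J" "0 \<le> m"
    and good: "card J < 2 * card {j\<in>J. pnorm p (y j - v) \<le> m}"
    and min: "is_arg_min (\<lambda>j. median {# pnorm p (y j - y j') powr p. j' \<in># mset_set J #}) (\<lambda>j. j \<in> J) k"
  shows "pnorm p (y k - v) \<le> 3 * m"
proof -
  let ?G = "{j\<in>J. pnorm p (y j - v) \<le> m}"
  let ?F = "\<lambda>j. median {# pnorm p (y j - y j') powr p. j' \<in># mset_set J #}"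
  have "?G \<noteq> {}" using good by (metis card.empty mult_0_right not_less_zero)
  then obtain g where g: "g \<in> J" "pnorm p (y g - v) \<le> m" by auto
  have tri: "pnorm p (u - w) \<le> pnorm p (u - x) + pnorm p (x - w)" for u w x :: "real ^ 'd"
    using pnorm_triangle[OF assms(1), of "u - x" "x - w"] by simp
  have "?G \<subseteq> {j'\<in>J. pnorm p (y g - y j') powr p \<le> (2 * m) powr p}"
  proof
    fix j' assume j': "j' \<in> ?G"
    have "pnorm p (y g - y j') \<le> 2 * m"
      using tri[of "y g" "y j'" v] g(2) j' pnorm_minus_commute[of p v "y j'"] by auto
    then show "j' \<in> {j'\<in>J. pnorm p (y g - y j') powr p \<le> (2 * m) powr p}"
      using j' assms(1) by (auto intro!: powr_mono2)
  qed
  then have "card ?G \<le> card {j'\<in>J. pnorm p (y g - y j') powr p \<le> (2 * m) powr p}"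
    using assms(2) by (intro card_mono) auto
  then have "?F g \<le> (2 * m) powr p" using assms(2) good by (intro median_le) auto
  moreover have "?F k \<le> ?F g" using min g(1) by (auto simp: is_arg_min_linorder)
  ultimately have "?F k \<le> (2 * m) powr p" by simp
  moreover have "J \<noteq> {}" using g by auto
  ultimately have half: "card J \<le> 2 * card {j'\<in>J. pnorm p (y k - y j') powr p \<le> (2 * m) powr p}" (is "_ \<le> 2 * card ?K")
    using assms(2) by (intro half_le_card_of_median_le) auto
  have "?K \<inter> ?G \<noteq> {}"
  proof
    assume "?K \<inter> ?G = {}"
    then have "card ?K + card ?G = card (?K \<union> ?G)"
      using assms(2) by (intro card_Un_disjoint[symmetric]) auto
    also have "\<dots> \<le> card J" using assms(2) by (intro card_mono) auto
    finally show False using half good by linarith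
  qed
  then obtain j where j: "pnorm p (y k - y j) powr p \<le> (2 * m) powr p" "pnorm p (y j - v) \<le> m" by auto
  have "pnorm p (y k - y j) \<le> 2 * m"
    using j(1) assms(1,3) powr_less_mono2[of p "2 * m" "pnorm p (y k - y j)"] by fastforce
  then show ?thesis using tri[of "y k" v "y j"] j(2) by linarith
qed

text \<open>Norms of good repetitions are within \<open>m\<close> of \<open>pnorm p v\<close>, and
  these repetitions form a strict majority. The premise \<open>m \<le> pnorm p v\<close> keeps the
  lower base in the range where powers are monotone.\<close>

lemma median_norm_bounds:
  fixes y :: "nat \<Rightarrow> real ^ 'd"
  assumes "1 \<le> p" "finite J" "0 \<le> m"
    and good: "card J < 2 * card {j\<in>J. pnorm p (y j - v) \<le> m}"
  shows "median {# pnorm p (y j) powr p. j \<in># mset_set J #} \<le> (pnorm p v + m) powr p"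
    and "m \<le> pnorm p v \<Longrightarrow> (pnorm p v - m) powr p \<le> median {# pnorm p (y j) powr p. j \<in># mset_set J #}"
proof -
  let ?G = "{j\<in>J. pnorm p (y j - v) \<le> m}"
  have le: "pnorm p (y j) \<le> pnorm p v + m" and ge: "pnorm p v - m \<le> pnorm p (y j)" if "j \<in> ?G" for j
    using pnorm_triangle[OF assms(1), of "y j - v" v] pnorm_triangle[OF assms(1), of "v - y j" "y j"]
      that pnorm_minus_commute[of p v "y j"] by auto
  have "card ?G \<le> card {j\<in>J. pnorm p (y j) powr p \<le> (pnorm p v + m) powr p}"
    using assms le by (intro card_mono) (auto intro!: powr_mono2)
  then show "median {# pnorm p (y j) powr p. j \<in># mset_set J #} \<le> (pnorm p v + m) powr p"
    using assms(2) good by (intro median_le) auto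
  assume "m \<le> pnorm p v"
  then have "card ?G \<le> card {j\<in>J. (pnorm p v - m) powr p \<le> pnorm p (y j) powr p}"
    using assms ge by (intro card_mono) (auto intro!: powr_mono2)
  then show "(pnorm p v - m) powr p \<le> median {# pnorm p (y j) powr p. j \<in># mset_set J #}"
    using assms(2) good by (intro le_median) auto
qed

text \<open>Both bounds replace the exponent \<open>p\<close> by 2, which raises powers of
  \<open>1 + \<epsilon> / 3\<close> and lowers powers of \<open>1 - \<epsilon> / 3\<close>; for
  squares the claim is elementary.\<close>

lemma pnorm_powr_relative_error:
  assumes p: "1 \<le> p" "p \<le> 2" and \<epsilon>: "0 < \<epsilon>" "\<epsilon> \<le> 1"
    and close: "pnorm p (w - v) \<le> (\<epsilon> / 3) * pnorm p v"
  shows "(1 - \<epsilon>) * pnorm p v powr p \<le> pnorm p w powr p"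
    and "pnorm p w powr p \<le> (1 + \<epsilon>) * pnorm p v powr p"
proof -
  have "pnorm p w \<le> (1 + \<epsilon> / 3) * pnorm p v"
    using pnorm_triangle[OF p(1), of "w - v" v] close by (simp add: distrib_right)
  then have "pnorm p w powr p \<le> ((1 + \<epsilon> / 3) * pnorm p v) powr p"
    using p by (intro powr_mono2) auto
  also have "\<dots> = (1 + \<epsilon> / 3) powr p * pnorm p v powr p"
    using \<epsilon> by (simp add: powr_mult)
  also have "(1 + \<epsilon> / 3) powr p \<le> (1 + \<epsilon> / 3) powr 2"
    using p \<epsilon> by (intro powr_mono) auto
  also have "\<dots> = (1 + \<epsilon> / 3)\<^sup>2" using \<epsilon> by simp
  also have "\<dots> \<le> 1 + \<epsilon>"
  proof -
    have "\<epsilon> * \<epsilon> \<le> 1 * \<epsilon>" using \<epsilon> by (intro mult_right_mono) auto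
    then have "\<epsilon> * \<epsilon> \<le> \<epsilon> * 3" using \<epsilon> by simp
    then show ?thesis by (simp add: power2_eq_square field_simps)
  qed
  finally show "pnorm p w powr p \<le> (1 + \<epsilon>) * pnorm p v powr p"
    by (simp add: mult_right_mono)
  have "1 - \<epsilon> \<le> (1 - \<epsilon> / 3)\<^sup>2" using \<epsilon> by (simp add: power2_eq_square field_simps)
  also have "\<dots> = (1 - \<epsilon> / 3) powr 2" using \<epsilon> by simp
  also have "\<dots> \<le> (1 - \<epsilon> / 3) powr p"
    using p \<epsilon> by (intro powr_mono') auto
  finally have "(1 - \<epsilon>) * pnorm p v powr p \<le> (1 - \<epsilon> / 3) powr p * pnorm p v powr p"
    by (intro mult_right_mono) auto
  also have "\<dots> = ((1 - \<epsilon> / 3) * pnorm p v) powr p"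
    using \<epsilon> by (simp add: powr_mult)
  also have "\<dots> \<le> pnorm p w powr p"
  proof (intro powr_mono2)
    show "(1 - \<epsilon> / 3) * pnorm p v \<le> pnorm p w"
      using pnorm_triangle[OF p(1), of "v - w" w] close pnorm_minus_commute[of p v w]
      by (simp add: left_diff_distrib)
  qed (use p \<epsilon> in auto)
  finally show "(1 - \<epsilon>) * pnorm p v powr p \<le> pnorm p w powr p" .
qed

text \<open>The deterministic half of the argument, for a single row: all randomness is confined to
  the premise \<open>good\<close>.\<close>

lemma heavy_hitter_output_correct:
  fixes B :: "nat \<Rightarrow> nat \<Rightarrow> real ^ 'd" and v :: "real ^ 'd"
  assumes p: "1 \<le> p" "p \<le> 2" and \<epsilon>: "0 < \<epsilon>" "\<epsilon> \<le> 1 / 20"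
    and N: "0 \<le> noise_level p s B"
    and good: "s < 2 * card {j\<in>{1..s}. pnorm p (row_estimate \<omega> B i j - v) powr p \<le> noise_level p s B}"
    and out: "heavy_hitter_output p \<epsilon> s \<omega> B L"
  shows "(i, a) \<in> L \<Longrightarrow> pnorm p (a - v) \<le> (\<epsilon> / 3) * pnorm p v"
    and "2 * ((12 / \<epsilon>) powr p * noise_level p s B) \<le> pnorm p v powr p \<Longrightarrow> \<exists>a. (i, a) \<in> L"
proof -
  define m where "m = noise_level p s B powr (1 / p)"
  define T where "T = 12 / \<epsilon>"
  have T: "T \<ge> 240" using \<epsilon> by (simp add: T_def field_simps)
  have m: "0 \<le> m" "m powr p = noise_level p s B"
    using p N by (simp_all add: m_def powr_powr)
  have le_iff: "x powr p \<le> z powr p \<longleftrightarrow> x \<le> z" if "0 \<le> x" "0 \<le> z" for x z :: real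
    using that p powr_mono2[of p x z] powr_less_mono2[of p z x] by fastforce
  have good': "card {1..s} < 2 * card {j\<in>{1..s}. pnorm p (row_estimate \<omega> B i j - v) \<le> m}"
    using good by (simp add: m(2)[symmetric] le_iff m(1))
  obtain pick where min: "is_arg_min (spread p s \<omega> B i) (\<lambda>j. j \<in> {1..s}) (pick i)"
    and L: "L = {(i, row_estimate \<omega> B i (pick i)) | i.
               norm_estimate p s \<omega> B i \<ge> (12 / \<epsilon>) powr p * noise_level p s B}"
    using out unfolding heavy_hitter_output_def by blast
  have Tm: "(12 / \<epsilon>) powr p * noise_level p s B = (T * m) powr p"
    using m T by (simp add: powr_mult T_def[symmetric])
  note bounds = median_norm_bounds[OF p(1) finite_atLeastAtMost m(1) good', folded norm_estimate_def]
  show "pnorm p (a - v) \<le> (\<epsilon> / 3) * pnorm p v" if "(i, a) \<in> L"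
  proof -
    have a: "a = row_estimate \<omega> B i (pick i)" and est: "(T * m) powr p \<le> norm_estimate p s \<omega> B i"
      using that unfolding L Tm by auto
    have "pnorm p (a - v) \<le> 3 * m"
      unfolding a using min unfolding spread_def[abs_def]
      by (rule arg_min_spread_close[OF p(1) finite_atLeastAtMost m(1) good'])
    moreover have "T * m \<le> pnorm p v + m"
      using order_trans[OF est bounds(1)] T m(1) by (subst (asm) le_iff) auto
    \<comment> \<open>Here \<open>\<epsilon> * (T - 1) = 12 - \<epsilon>\<close>; the 9 is the
      factor 3 from \<open>arg_min_spread_close\<close> times the 3 in
      \<open>\<epsilon> / 3\<close>.\<close>
    moreover have "9 * m \<le> \<epsilon> * ((T - 1) * m)"
    proof -
      have "9 \<le> \<epsilon> * (T - 1)" using \<epsilon> by (simp add: T_def field_simps)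
      then show ?thesis using m(1) mult_right_mono[of 9 "\<epsilon> * (T - 1)" m] by (simp add: mult.assoc)
    qed
    moreover have "\<epsilon> * ((T - 1) * m) \<le> \<epsilon> * pnorm p v"
      using calculation(2) \<epsilon> by (intro mult_left_mono) (auto simp: left_diff_distrib)
    ultimately show ?thesis by linarith
  qed
  show "\<exists>a. (i, a) \<in> L" if heavy: "2 * ((12 / \<epsilon>) powr p * noise_level p s B) \<le> pnorm p v powr p"
  proof -
    \<comment> \<open>The median is only bounded below through \<open>pnorm p v - m\<close>, so
      \<open>T + 1\<close> is required in place of \<open>T\<close>. The factor 2 in
      \<open>heavy\<close> pays for this because \<open>T \<ge> 240\<close>.\<close>
    have "((T + 1) * m) powr p = (1 + 1 / T) powr p * (T * m) powr p"
    proof -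
      have "(T + 1) * m = (1 + 1 / T) * (T * m)" using T by (simp add: field_simps)
      then show ?thesis using T m(1) by (simp only: powr_mult)
    qed
    also have "(1 + 1 / T) powr p \<le> (1 + 1 / T) powr 2" using p T by (intro powr_mono) auto
    also have "\<dots> = (1 + 1 / T)\<^sup>2" using T by simp
    also have "\<dots> \<le> (1 + 1 / 240)\<^sup>2" using T by (intro power_mono add_left_mono divide_left_mono) auto
    also have "\<dots> \<le> 2" by (simp add: power2_eq_square)
    finally have "((T + 1) * m) powr p \<le> pnorm p v powr p"
      using heavy unfolding Tm by (auto simp: mult_right_mono)
    then have Tv: "(T + 1) * m \<le> pnorm p v" using T m(1) by (subst (asm) le_iff) auto
    moreover have "0 \<le> T * m" using T m(1) by simp
    ultimately have "m \<le> pnorm p v" "T * m \<le> pnorm p v - m"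
      unfolding distrib_right by linarith+
    then have "(T * m) powr p \<le> norm_estimate p s \<omega> B i"
      using T m(1) p(1) by (intro order_trans[OF _ bounds(2)] powr_mono2) auto
    then show ?thesis unfolding L Tm by auto
  qed
qed

section \<open>From columns to the sketch and its tail bounds\<close>

lemma sketch_eq_bucket_sum:
  "sketch \<omega> us j b = bucket_sum (($) (final_matrix us)) (coin_columns \<omega> j) b"
  by (cases \<omega>) (simp add: sketch_eq_sum coin_columns_def bucket_sum_def)

lemma row_estimate_minus_row:
  "row_estimate \<omega> (sketch \<omega> us) i j - final_matrix us $ i
    = row_error (($) (final_matrix us)) i (coin_columns \<omega> j)"
  by (cases \<omega>)
    (simp add: row_error_def row_estimate_def sketch_eq_bucket_sum[unfolded coin_columns_def] coin_columns_def)

text \<open>Hoeffding with margin 0.025: the size of \<open>s\<close> makes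
  \<open>2 * s * 0.025\<^sup>2\<close> exceed the logarithm. The resulting probability leaves room
  for a union bound over all rows and two further events.\<close>

lemma prob_coin_columns_count_le:
  fixes E :: "(('n::finite \<Rightarrow> nat) \<times> ('n \<Rightarrow> real)) set"
  assumes \<delta>: "0 < \<delta>" "\<delta> \<le> 1" and s: "real s \<ge> 3 * ln (6 * real CARD('n) / \<delta>) / 0.025 ^ 3"
    and E: "x + 0.025 \<le> measure_pmf.prob (column_pmf r) E"
  shows "measure_pmf.prob (coins_pmf s r)
      {\<omega>. real (card {j\<in>{1..s}. coin_columns \<omega> j \<in> E}) \<le> x * real s} \<le> \<delta> / (6 * real CARD('n))"
proof -
  let ?L = "ln (6 * real CARD('n) / \<delta>)"
  have n: "real CARD('n) \<ge> 1" by (simp add: Suc_le_eq)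
  then have "\<delta> < 6 * real CARD('n)" using \<delta> by linarith
  then have pos: "6 * real CARD('n) / \<delta> > 1" using \<delta> by simp
  then have L: "?L > 0" by simp
  then have "0 < real s" using s by (intro less_le_trans[OF _ s]) simp
  then have "{1..s} \<noteq> {}" by simp
  then have "measure_pmf.prob (coins_pmf s r)
      {\<omega>. real (card {j\<in>{1..s}. coin_columns \<omega> j \<in> E}) \<le> x * real s} \<le> exp (- 2 * real s * 0.025\<^sup>2)"
    using prob_count_le[of "{1..s}" "0.025" x "column_pmf r" E "(\<lambda>_. 1, \<lambda>_. 1)"] E
    by (subst prob_coins_pmf_columns[where P = "\<lambda>c. real (card {j\<in>{1..s}. c j \<in> E}) \<le> x * real s"]) simp
  also have "\<dots> \<le> exp (- ?L)"
    using s L by (simp add: power2_eq_square power3_eq_cube)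
  also have "\<dots> = \<delta> / (6 * real CARD('n))"
    using pos \<delta> n by (simp add: exp_minus)
  finally show ?thesis .
qed

theorem theorem2p1:
  fixes p \<epsilon> \<delta> \<gamma> M :: real
    and r s t :: nat
    and us :: "('n::finite, 'd::finite) turnstile_update list"
    and A :: "real ^ 'd ^ 'n"
    and S\<^sub>R :: "'n set"
  assumes p: "p \<in> {1..2}"
    and eps: "\<epsilon> \<in> {0<..1/20}"
    and delta: "\<delta> \<in> {0<..1/20}"
    and gamma: "\<gamma> \<in> {0<..<1}"
    and A: "A = final_matrix us"
    and r: "real r = 8 * inverse \<gamma> * (12 / \<epsilon>) powr p"
    and s: "real s \<ge> 3 * ln (6 * real CARD('n) / \<delta>) / 0.025 ^ 3"
    \<comment> \<open>\<open>t\<close> is \<open>r / 20\<close>, rounded either way if it is not an integer\<close>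
    and t: "\<bar>real t - real r / 20\<bar> < 1"
    and S\<^sub>R: "remaining_rows p A t S\<^sub>R"
    and M: "M = (\<Sum>i\<in>S\<^sub>R. pnorm p (A $ i) powr p)"
  shows "measure_pmf.prob (coins_pmf s r :: 'n coins pmf)
    {\<omega>. \<forall>L. heavy_hitter_output p \<epsilon> s \<omega> (sketch \<omega> us) L \<longrightarrow>
        (\<forall>(i, a) \<in> L.
            pnorm p (a - A $ i) \<le> (\<epsilon> / 3) * pnorm p (A $ i) \<and>
            (1 - \<epsilon>) * pnorm p (A $ i) powr p \<le> pnorm p a powr p \<and>
            pnorm p a powr p \<le> (1 + \<epsilon>) * pnorm p (A $ i) powr p) \<and>
        (\<forall>i. pnorm p (A $ i) powr p \<ge> \<gamma> * M \<longrightarrow> (\<exists>a. (i, a) \<in> L))}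
    \<ge> 1 - \<delta>"
    (is "measure_pmf.prob ?P ?Good \<ge> 1 - \<delta>")
proof -
  have p': "1 \<le> p" "p \<le> 2" and \<epsilon>: "0 < \<epsilon>" "\<epsilon> \<le> 1 / 20" and \<delta>: "0 < \<delta>" "\<delta> \<le> 1"
    using p eps delta by auto
  let ?n = "real CARD('n)"
  have n: "?n \<ge> 1" by (simp add: Suc_le_eq)
  \<comment> \<open>A numerical lower bound on \<open>r\<close>, so that terms of order
    \<open>1 / r\<close> fit into the constants below.\<close>
  have "240 \<le> (12 / \<epsilon>) powr 1" using \<epsilon> by (simp add: field_simps)
  also have "\<dots> \<le> (12 / \<epsilon>) powr p" using p' \<epsilon> by (intro powr_mono) (auto simp: field_simps)
  finally have "8 * 1 * 240 \<le> real r"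
    unfolding r using gamma by (intro mult_mono) (auto simp: one_le_inverse_iff)
  then have r_ge: "1920 \<le> real r" by simp
  then have r_pos: "0 < r" by (cases r) auto

  define row where "row = ($) A"
  define X where "X c = pnorm p (bucket_sum row c 1) powr p" for c
  define Z where "Z i c = pnorm p (row_error row i c) powr p" for i c
  define noise where "noise \<omega> = noise_level p s (sketch \<omega> us)" for \<omega>
  have noise_eq: "noise \<omega> = percentile 0.65 {# X (coin_columns \<omega> j). j \<in># mset_set {1..s} #}" for \<omega>
    by (simp add: noise_def noise_level_def X_def row_def A sketch_eq_bucket_sum)

  \<comment> \<open>The noise level depends on all repetitions at once, so errors are first compared
    with the deterministic \<open>q\<close>. Level 0.625 serves both sides:
    \<open>q \<le> X c\<close> has probability at least 0.375 = 0.35 + 0.025, and an error at most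
    \<open>q\<close> has at least 0.625 - 0.02 = 0.58 + 0.025.\<close>
  obtain q where q: "0.625 \<le> measure_pmf.prob (column_pmf r) {c. X c \<le> q}"
      "measure_pmf.prob (column_pmf r) {c. X c < q} \<le> 0.625"
    using exists_quantile[OF finite_set_column_pmf[OF r_pos], of "0.625" X] by auto

  define count where "count E \<omega> = real (card {j\<in>{1..s}. coin_columns \<omega> j \<in> E})"
    for E and \<omega> :: "'n coins"
  define Bad\<^sub>1 where "Bad\<^sub>1 = {\<omega>. count {c. q \<le> X c} \<omega> \<le> 0.35 * real s}"
  define Bad\<^sub>2 where "Bad\<^sub>2 = {\<omega>. count {c. X c \<le> 4 * M / real r} \<omega> \<le> 0.65 * real s}"
  define Bad\<^sub>3 where "Bad\<^sub>3 i = {\<omega>. count {c. Z i c \<le> q} \<omega> \<le> 0.58 * real s}" for i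
  note tail = prob_coin_columns_count_le[OF \<delta> s, folded count_def]

  have "measure_pmf.prob (column_pmf r) {c. q \<le> X c} = 1 - measure_pmf.prob (column_pmf r) {c. X c < q}"
    using measure_pmf.prob_compl[of "{c. X c < q}" "column_pmf r :: (('n \<Rightarrow> nat) \<times> ('n \<Rightarrow> real)) pmf"]
    by (simp add: set_diff_eq not_less)
  then have bad1: "measure_pmf.prob ?P Bad\<^sub>1 \<le> \<delta> / (6 * ?n)"
    unfolding Bad\<^sub>1_def using q(2) by (intro tail) simp

  \<comment> \<open>Rounding \<open>t\<close> removes at most one row beyond \<open>r / 20\<close>.
    With \<open>K = 4\<close> the probability is at least 1 - 0.075 - 0.25 = 0.65 + 0.025.\<close>
  have "real (card (- S\<^sub>R)) \<le> real r / 20 + 1"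
    using S\<^sub>R t unfolding remaining_rows_def by linarith
  then have "real (card (- S\<^sub>R)) / real r \<le> (real r / 20 + 1) / real r"
    by (intro divide_right_mono) auto
  also have "\<dots> \<le> 0.075" using r_ge by (simp add: field_simps)
  finally have bad2: "measure_pmf.prob ?P Bad\<^sub>2 \<le> \<delta> / (6 * ?n)"
    unfolding Bad\<^sub>2_def using prob_bucket_sum_le[OF p' r_pos, of 4 S\<^sub>R row]
    by (intro tail) (simp add: X_def M row_def)

  have bad3: "measure_pmf.prob ?P (Bad\<^sub>3 i) \<le> \<delta> / (6 * ?n)" for i
  proof -
    have "1 / real r \<le> 0.02" using r_ge by (simp add: field_simps)
    then show ?thesis
      unfolding Bad\<^sub>3_def
      using q(1) prob_row_error_ge[OF r_pos, of "\<lambda>v. pnorm p v powr p \<le> q" row i]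
      by (intro tail) (simp add: Z_def X_def pnorm_minus)
  qed

  have good: "\<omega> \<in> ?Good" if "\<omega> \<notin> Bad\<^sub>1" "\<omega> \<notin> Bad\<^sub>2" "\<And>i. \<omega> \<notin> Bad\<^sub>3 i" for \<omega>
  proof -
    have "s \<noteq> 0"
    proof
      assume "s = 0"
      then have "count {c. q \<le> X c} \<omega> = 0" by (simp add: count_def)
      then show False using that(1) \<open>s = 0\<close> by (simp add: Bad\<^sub>1_def)
    qed
    then have s_pos: "{1..s} \<noteq> {}" by simp
    \<comment> \<open>More than 35 percent of the columns reach \<open>q\<close>, so fewer than 65
      percent lie below it, which places the 0.65-percentile at \<open>q\<close> or above.\<close>
    have "card {j\<in>{1..s}. q \<le> X (coin_columns \<omega> j)} + card {j\<in>{1..s}. X (coin_columns \<omega> j) < q}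
        = card ({j\<in>{1..s}. q \<le> X (coin_columns \<omega> j)} \<union> {j\<in>{1..s}. X (coin_columns \<omega> j) < q})"
      by (intro card_Un_disjoint[symmetric]) auto
    also have "{j\<in>{1..s}. q \<le> X (coin_columns \<omega> j)} \<union> {j\<in>{1..s}. X (coin_columns \<omega> j) < q} = {1..s}" by auto
    finally have "real (card {j\<in>{1..s}. X (coin_columns \<omega> j) < q}) < 0.65 * real (card {1..s})"
      using that(1) by (simp add: Bad\<^sub>1_def count_def)
    then have noise_ge: "q \<le> noise \<omega>"
      unfolding noise_eq using s_pos by (intro le_percentile) auto
    have noise_nonneg: "0 \<le> noise \<omega>"
      unfolding noise_eq using s_pos by (intro le_percentile) (auto simp: X_def not_less)
    have "noise \<omega> \<le> 4 * M / real r"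
      unfolding noise_eq using s_pos that(2) by (intro percentile_le) (auto simp: Bad\<^sub>2_def count_def)
    then have "2 * ((12 / \<epsilon>) powr p * noise \<omega>) \<le> 2 * ((12 / \<epsilon>) powr p * (4 * M / real r))"
      by (intro mult_left_mono) auto
    \<comment> \<open>The 8 in \<open>r\<close> is the 2 required for completeness times the 4 from
      Markov's inequality.\<close>
    also have "\<dots> = \<gamma> * M" unfolding r using gamma \<epsilon> by (simp add: field_simps)
    finally have noise_le: "2 * ((12 / \<epsilon>) powr p * noise \<omega>) \<le> \<gamma> * M" .
    have close: "s < 2 * card {j\<in>{1..s}.
        pnorm p (row_estimate \<omega> (sketch \<omega> us) i j - A $ i) powr p \<le> noise \<omega>}" (is "_ < 2 * card ?K") for i
    proof -
      have "{j\<in>{1..s}. coin_columns \<omega> j \<in> {c. Z i c \<le> q}} \<subseteq> ?K"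
        using noise_ge by (auto simp: A row_estimate_minus_row Z_def row_def)
      then have "card {j\<in>{1..s}. coin_columns \<omega> j \<in> {c. Z i c \<le> q}} \<le> card ?K"
        by (intro card_mono) auto
      moreover have "58 / 100 * real s < real (card {j\<in>{1..s}. coin_columns \<omega> j \<in> {c. Z i c \<le> q}})"
        using that(3)[of i] by (simp add: Bad\<^sub>3_def count_def)
      ultimately show ?thesis by linarith
    qed
    note correct = heavy_hitter_output_correct[OF p' \<epsilon>, of s "sketch \<omega> us" \<omega>,
        folded noise_def, OF noise_nonneg close]
    have \<epsilon>': "\<epsilon> \<le> 1" using \<epsilon> by simp
    show ?thesis
      using correct(1) correct(2)[OF _ order_trans[OF noise_le]]
        pnorm_powr_relative_error[OF p' \<epsilon>(1) \<epsilon>'] by blast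
  qed

  \<comment> \<open>Union bound over \<open>CARD('n) + 2\<close> events of probability at most
    \<open>\<delta> / (6 * ?n)\<close> each, in total at most \<open>\<delta> / 2\<close>.\<close>
  have "- ?Good \<subseteq> (Bad\<^sub>1 \<union> Bad\<^sub>2) \<union> (\<Union>i. Bad\<^sub>3 i)"
    using good by blast
  then have "measure_pmf.prob ?P (- ?Good) \<le> measure_pmf.prob ?P ((Bad\<^sub>1 \<union> Bad\<^sub>2) \<union> (\<Union>i. Bad\<^sub>3 i))"
    by (intro measure_pmf.finite_measure_mono) auto
  also have "\<dots> \<le> measure_pmf.prob ?P (Bad\<^sub>1 \<union> Bad\<^sub>2) + measure_pmf.prob ?P (\<Union>i. Bad\<^sub>3 i)"
    by (intro measure_Un_le) auto
  also have "measure_pmf.prob ?P (Bad\<^sub>1 \<union> Bad\<^sub>2) \<le> measure_pmf.prob ?P Bad\<^sub>1 + measure_pmf.prob ?P Bad\<^sub>2"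
    by (intro measure_Un_le) auto
  also have "measure_pmf.prob ?P (\<Union>i. Bad\<^sub>3 i) \<le> (\<Sum>i\<in>UNIV. measure_pmf.prob ?P (Bad\<^sub>3 i))"
    by (intro measure_pmf.finite_measure_subadditive_finite) auto
  also have "\<dots> \<le> (\<Sum>i\<in>(UNIV :: 'n set). \<delta> / (6 * ?n))"
    by (intro sum_mono bad3)
  finally have "measure_pmf.prob ?P (- ?Good) \<le> 2 * (\<delta> / (6 * ?n)) + ?n * (\<delta> / (6 * ?n))"
    using bad1 bad2 by simp
  also have "\<dots> \<le> \<delta>"
  proof -
    have "\<delta> / (6 * ?n) \<le> \<delta> / 6" using \<delta> n by (intro divide_left_mono) auto
    moreover have "?n * (\<delta> / (6 * ?n)) = \<delta> / 6" using n by simp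
    ultimately show ?thesis using \<delta> by linarith
  qed
  finally have "measure_pmf.prob ?P (- ?Good) \<le> \<delta>" .
  moreover have "measure_pmf.prob ?P (- ?Good) = 1 - measure_pmf.prob ?P ?Good"
    using measure_pmf.prob_compl[of ?Good ?P] by (simp add: Compl_eq_Diff_UNIV)
  ultimately show ?thesis by linarith
qed

end
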